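(* Let $(\lambda_n)_{n\in\mathbb{N}}$ be a sequence of real numbers with $\lambda_n>1$ for all $n$, such that $$\lambda_n\Big(1+\frac{1}{\log\lambda_n}\Big)<\lambda_{n+1}\Big(1-\frac{1}{\log\lambda_{n+1}}\Big)\ \text{ for all } n\in\mathbb{N}\qquad\text{and}\qquad \sum_{n\in\mathbb{N}}\frac{1}{\log^2\lambda_n}<\infty .$$ Let $f\in L^2(\mathbb{R})$ be such that $\widehat f$ is supported on (i.e. vanishes a.e. outside) the set $$\Sigma=\bigcup_{n\in\mathbb{N}}\big([-\lambda_n-1,-\lambda_n]\cup[\lambda_n,\lambda_n+1]\big).$$ If $f=0$ (a.e.) on some nonempty open subset of $\mathbb{R}$, then $f\equiv0$ (a.e. on $\mathbb{R}$).
   Context: Fourier transform: $\widehat f(\xi)=\int_{\mathbb{R}}f(x)e^{-2\pi i x\xi}\,dx$ (extended to $L^2(\mathbb{R})$). Here $\log$ is the natural logarithm and $\mathbb{N}=\{1,2,\dots\}$. *)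

theory Defs
  imports "HOL-Analysis.Analysis"
begin

definition L2_fun :: "(real \<Rightarrow> complex) \<Rightarrow> bool" where
  "L2_fun f \<longleftrightarrow> f \<in> borel_measurable lebesgue \<and> integrable lebesgue (\<lambda>x. (norm (f x))\<^sup>2)"

definition fourier_L1 :: "(real \<Rightarrow> complex) \<Rightarrow> real \<Rightarrow> complex" where
  "fourier_L1 f \<xi> =
     (\<integral>x. f x * exp (- 2 * of_real pi * \<i> * of_real x * of_real \<xi>) \<partial>lebesgue)"

text \<open>The squared distance is a nonnegative integral, so that it is \<open>\<infinity>\<close>, rather than the
  default value 0 of the Bochner integral, if the difference is not square integrable.\<close>

definition L2_tendsto :: "(nat \<Rightarrow> real \<Rightarrow> complex) \<Rightarrow> (real \<Rightarrow> complex) \<Rightarrow> bool" where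
  "L2_tendsto h f \<longleftrightarrow>
     (\<lambda>k. \<integral>\<^sup>+x. ennreal ((norm (h k x - f x))\<^sup>2) \<partial>lebesgue) \<longlonglongrightarrow> 0"

text \<open>The extension of \<open>fourier_L1\<close> from \<open>L\<^sup>1 \<inter> L\<^sup>2\<close> to \<open>L\<^sup>2\<close> by continuity. It is a relation
  because elements of \<open>L\<^sup>2\<close> are represented by functions: \<open>has_fourier_L2 f g\<close> says that
  \<open>g\<close> is a representative of the Fourier transform of \<open>f\<close>. By Plancherel's theorem such a \<open>g\<close>
  exists for every \<open>f\<close> in \<open>L\<^sup>2\<close>, is unique almost everywhere, and does not depend on the
  approximating sequence \<open>h\<close>.\<close>

definition has_fourier_L2 :: "(real \<Rightarrow> complex) \<Rightarrow> (real \<Rightarrow> complex) \<Rightarrow> bool" where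
  "has_fourier_L2 f g \<longleftrightarrow> L2_fun f \<and> L2_fun g \<and>
     (\<exists>h. (\<forall>k. integrable lebesgue (h k) \<and> L2_fun (h k)) \<and>
          L2_tendsto h f \<and> L2_tendsto (\<lambda>k. fourier_L1 (h k)) g)"

end

theory Submission
  imports Defs "HOL-Complex_Analysis.Complex_Analysis" "HOL-Probability.Probability"
    "HOL-Real_Asymp.Real_Asymp"
begin

text \<open>
  Multiplying \<open>f\<close> by the inverse Fourier transform \<open>w\<close> of an indicator function of length 1 gives an
  integrable \<open>g\<close> that still vanishes near a point \<open>c\<close> and whose transform is continuous and supported
  in \<open>E = {x. \<exists>n. l n - 1 \<le> \<bar>x\<bar> \<le> l n + 2}\<close>. The Laplace integrals of \<open>g\<close> over \<open>[c, \<infinity>)\<close>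
  and over \<open>(-\<infinity>, c)\<close> (the latter with a minus sign) are defined in the lower and the upper half-plane,
  and they agree on the real line off \<open>E\<close>. So they form one function \<open>G\<close> that is holomorphic off \<open>E\<close>
  and bounded by \<open>C exp (- b \<bar>Im z\<bar>)\<close>.

  Since \<open>\<Sum> 1 / (ln (l n))\<^sup>2\<close> converges, there are polynomials \<open>H\<close> with roots at \<open>\<plusminus>l n\<close> such that
  \<open>\<bar>H\<bar> \<le> 1\<close> on \<open>E\<close>, \<open>\<bar>H\<bar> \<ge> h > 1\<close> at a given point of the imaginary axis and
  \<open>\<bar>H\<bar> \<le> exp (R powr (1/4))\<close> on the circle of radius \<open>R\<close>. On that circle the decay of \<open>G\<close>
  outweighs \<open>H ^ M\<close> except on two arcs around \<open>\<plusminus>R\<close>, which are so short that they are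
  negligible for the maximum principle. Hence \<open>\<bar>G\<bar> h ^ M \<le> C\<close> for every \<open>M\<close>, so \<open>G = 0\<close> and \<open>f = 0\<close>.
\<close>

subsection \<open>A maximum principle in a slit disc\<close>

text \<open>If the bound failed, by \<open>2 * e\<close> say, the superlevel set \<open>S\<close> at
  height \<open>B + e\<close> would be open and \<open>lim\<close> would keep its closure off
  \<open>K\<close>. Then \<open>\<Psi>\<close> is continuous up to the frontier of \<open>S\<close>,
  where its modulus is at most \<open>B + e\<close>, against the maximum modulus principle.
  \<open>K\<close> may also meet the bounding circle.\<close>

lemma maximum_modulus_punctured_cball:
  fixes \<Psi> :: "complex \<Rightarrow> complex"
  assumes K: "closed K"
    and hol: "\<Psi> holomorphic_on ball 0 R - K"
    and cont: "continuous_on (cball 0 R - K) \<Psi>"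
    and sph: "\<And>z. norm z = R \<Longrightarrow> z \<notin> K \<Longrightarrow> norm (\<Psi> z) \<le> B"
    and lim: "\<And>\<zeta> e. \<zeta> \<in> K \<Longrightarrow> norm \<zeta> \<le> R \<Longrightarrow> e > 0 \<Longrightarrow>
                \<forall>\<^sub>F z in at \<zeta> within (cball 0 R - K). norm (\<Psi> z) < B + e"
    and w: "norm w < R" "w \<notin> K"
  shows "norm (\<Psi> w) \<le> B"
proof (rule ccontr)
  assume "\<not> norm (\<Psi> w) \<le> B"
  define e where "e = (norm (\<Psi> w) - B) / 2"
  have e: "e > 0" "B + e < norm (\<Psi> w)"
    using \<open>\<not> norm (\<Psi> w) \<le> B\<close> by (auto simp: e_def field_simps)
  define S where "S = {z \<in> ball 0 R - K. B + e < norm (\<Psi> z)}"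
  have opn: "open (ball 0 R - K)" using K by auto
  have cont': "continuous_on (ball 0 R - K) \<Psi>"
    by (rule continuous_on_subset[OF cont]) auto
  have "openin (top_of_set (ball 0 R - K)) ((ball 0 R - K) \<inter> (\<lambda>z. norm (\<Psi> z)) -` {B+e<..})"
    by (rule continuous_openin_preimage_gen) (intro continuous_intros cont', simp)
  moreover have "(ball 0 R - K) \<inter> (\<lambda>z. norm (\<Psi> z)) -` {B+e<..} = S"
    by (auto simp: S_def)
  ultimately have S: "open S" using opn openin_open_trans by fastforce
  have clo: "z \<in> cball 0 R - K \<and> B + e \<le> norm (\<Psi> z)" if "z \<in> closure S" for z
  proof -
    have zR: "z \<in> cball 0 R"
    proof -
      have "closure S \<subseteq> cball 0 R" by (rule closure_minimal) (auto simp: S_def)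
      then show ?thesis using that by auto
    qed
    show ?thesis
    proof (cases "z \<in> S")
      case True then show ?thesis by (auto simp: S_def)
    next
      case False
      then have "z islimpt S" using that by (auto simp: closure_def)
      then have nt: "at z within S \<noteq> bot" by (simp add: trivial_limit_within)
      have le: "at z within S \<le> at z within (cball 0 R - K)"
        by (rule at_le) (auto simp: S_def)
      have ev: "\<forall>\<^sub>F x in at z within S. B + e < norm (\<Psi> x)"
        by (auto simp: eventually_at_filter S_def)
      have nK: "z \<notin> K"
      proof
        assume "z \<in> K"
        then have "\<forall>\<^sub>F x in at z within S. norm (\<Psi> x) < B + e"
          using lim[of z e] zR e le by (auto intro: filter_leD)
        with ev have "\<forall>\<^sub>F x in at z within S. False"
          by eventually_elim auto
        with nt show False by simp
      qed
      have "((\<lambda>x. norm (\<Psi> x)) \<longlongrightarrow> norm (\<Psi> z)) (at z within (cball 0 R - K))"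
        using cont zR nK by (intro tendsto_norm) (auto simp: continuous_on_def)
      then have "((\<lambda>x. norm (\<Psi> x)) \<longlongrightarrow> norm (\<Psi> z)) (at z within S)"
        using le by (rule tendsto_mono[rotated])
      then have "B + e \<le> norm (\<Psi> z)"
        by (rule tendsto_lowerbound[OF _ _ nt]) (use ev in eventually_elim, auto)
      then show ?thesis using zR nK by auto
    qed
  qed
  have "norm (\<Psi> w) \<le> B + e"
  proof (rule maximum_modulus_frontier[of \<Psi> S])
    show "\<Psi> holomorphic_on interior S"
      using hol S by (auto simp: interior_open S_def intro: holomorphic_on_subset)
    show "continuous_on (closure S) \<Psi>"
      by (rule continuous_on_subset[OF cont]) (use clo in auto)
    show "bounded S" by (rule bounded_subset[of "ball 0 R"]) (auto simp: S_def)
    show "w \<in> S" using w e by (auto simp: S_def)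
    fix z assume z: "z \<in> frontier S"
    then have zc: "z \<in> closure S" and zS: "z \<notin> S"
      using S by (auto simp: frontier_def interior_open)
    show "norm (\<Psi> z) \<le> B + e"
    proof (cases "norm z = R")
      case True then show ?thesis using sph[of z] clo[OF zc] e by auto
    next
      case False then show ?thesis using clo[OF zc] zS by (auto simp: S_def)
    qed
  qed
  with e show False by simp
qed

text \<open>Expand by the conjugate of the denominator. The result is a Poisson kernel: positive in
  the disc and large near the pole \<open>\<rho>\<close>.\<close>

lemma Re_Poisson_quotient:
  fixes z :: complex and \<rho> :: real
  assumes "norm z < \<rho>"
  shows "Re ((of_real \<rho> + z) / (of_real \<rho> - z)) = (\<rho>\<^sup>2 - (norm z)\<^sup>2) / (norm (of_real \<rho> - z))\<^sup>2"
proof -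
  have "Re ((of_real \<rho> + z) / (of_real \<rho> - z)) =
     Re ((of_real \<rho> + z) * cnj (of_real \<rho> - z)) / (norm (of_real \<rho> - z))\<^sup>2"
    by (simp add: Re_complex_div_eq_0 complex_div_cnj[of "of_real \<rho> + z"] Re_divide_of_real)
  also have "Re ((of_real \<rho> + z) * cnj (of_real \<rho> - z)) = \<rho>\<^sup>2 - (norm z)\<^sup>2"
    unfolding cmod_power2 by (simp add: power2_eq_square algebra_simps)
  finally show ?thesis .
qed

text \<open>The factor \<open>exp (- c Q)\<close> in the proof, where \<open>Q\<close> is the sum of the Herglotz kernels with
  poles at \<open>\<plusminus>\<rho>\<close> just outside the disc, has modulus at most 1 in the disc, is smaller than
  \<open>exp (- p)\<close> on the two arcs \<open>\<bar>Im z\<bar> \<le> p / b\<close> of the circle, and costs only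
  \<open>exp (- 8 c)\<close> with \<open>c = O(p\<^sup>2 / R)\<close> near the centre.\<close>

lemma norm_le_slit_disc:
  fixes G H :: "complex \<Rightarrow> complex"
  assumes K: "closed K" and G: "G holomorphic_on -K"
    and Gb: "\<And>z. norm (G z) \<le> C * exp (- b * \<bar>Im z\<bar>)" and b: "b > 0"
    and H: "H holomorphic_on UNIV"
    and Hs: "\<And>z. norm z = R \<Longrightarrow> norm (H z) \<le> exp p" and p: "p > 0" and R: "R > 0"
    and HK: "\<And>z. z \<in> K \<Longrightarrow> norm z \<le> R \<Longrightarrow> norm (H z) \<le> 1"
    and w: "w \<notin> K" "2 * norm w \<le> R"
  shows "norm (G w) * norm (H w) \<le> C * exp (36 * p\<^sup>2 / (b * R))"
proof -
  have "norm (G 0) \<le> C" using Gb[of 0] by simp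
  then have C: "C \<ge> 0" using norm_ge_zero[of "G 0"] by linarith
  have GC: "norm (G z) \<le> C" for z
  proof -
    have "C * exp (- b * \<bar>Im z\<bar>) \<le> C * 1"
      using C b by (intro mult_left_mono) auto
    then show ?thesis using Gb[of z] by linarith
  qed
  \<comment> \<open>The height above which the decay \<open>exp (- b * \<bar>Im z\<bar>)\<close> of
    \<open>G\<close> absorbs the bound \<open>exp p\<close> on \<open>H\<close>. The poles of
    \<open>Q\<close> lie at this same distance outside the circle.\<close>
  define d where "d = p / b"
  define \<rho> where "\<rho> = R + d"
  \<comment> \<open>Chosen so that \<open>c\<close> times \<open>2 * R / (9 * d)\<close>, the lower
    bound for \<open>Re (Q z)\<close> on the arcs, is exactly \<open>p\<close>; \<open>8 * c\<close>
    is then the exponent lost at \<open>w\<close>.\<close>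
  define c where "c = 9 * p\<^sup>2 / (2 * b * R)"
  have d: "d > 0" and c: "c > 0" and \<rho>: "\<rho> > R" "\<rho> > 0" using p b R by (auto simp: d_def c_def \<rho>_def add_pos_pos)
  define P where "P = (\<lambda>z::complex. (of_real \<rho> + z) / (of_real \<rho> - z))"
  define Q where "Q = (\<lambda>z. P z + P (-z))"
  have nz: "of_real \<rho> - z \<noteq> 0" "of_real \<rho> + z \<noteq> 0" if "norm z \<le> R" for z :: complex
  proof -
    show "of_real \<rho> - z \<noteq> 0"
      using that \<rho> by auto
    have "of_real \<rho> + z = 0 \<Longrightarrow> z = - of_real \<rho>"
      by (simp add: eq_neg_iff_add_eq_0 add.commute)
    then show "of_real \<rho> + z \<noteq> 0" using that \<rho> by auto
  qed
  have ReP: "Re (P z) = (\<rho>\<^sup>2 - (norm z)\<^sup>2) / (norm (of_real \<rho> - z))\<^sup>2" if "norm z \<le> R" for z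
    unfolding P_def by (rule Re_Poisson_quotient) (use that \<rho> in auto)
  have ReP0: "Re (P z) \<ge> 0" if "norm z \<le> R" for z
    using ReP[OF that] that \<rho> by (auto intro!: divide_nonneg_nonneg power_mono)
  have ReQ0: "Re (Q z) \<ge> 0" if "norm z \<le> R" for z
    using ReP0[of z] ReP0[of "-z"] that by (auto simp: Q_def)
  have ReP4: "Re (P z) \<le> 4" if "2 * norm z \<le> R" for z
  proof -
    have le: "norm z \<le> R" using that R norm_ge_zero[of z] by linarith
    have "\<rho> / 2 \<le> norm (of_real \<rho> - z)"
      using norm_triangle_ineq2[of "of_real \<rho>" z] that \<rho> by simp
    then have "(\<rho> / 2)\<^sup>2 \<le> (norm (of_real \<rho> - z))\<^sup>2"
      using \<rho> by (intro power_mono) auto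
    then have "Re (P z) \<le> \<rho>\<^sup>2 / (\<rho> / 2)\<^sup>2"
      unfolding ReP[OF le] using \<rho> by (intro frac_le) auto
    then show ?thesis using \<rho> by (simp add: field_simps)
  qed
  have ReQ8: "Re (Q w) \<le> 8" using ReP4[of w] ReP4[of "-w"] w by (simp add: Q_def)
  have ReP_arc: "2 * R / (9 * d) \<le> Re (P z)" if z: "norm z = R" "\<bar>Im z\<bar> \<le> d" "Re z \<ge> 0" for z
  proof -
    have z2: "(Re z)\<^sup>2 + (Im z)\<^sup>2 = R\<^sup>2" using z(1) by (auto simp: cmod_power2)
    have rz: "Re z \<le> R" using abs_Re_le_cmod[of z] z by auto
    have iz: "(Im z)\<^sup>2 \<le> d\<^sup>2" using z d by (metis abs_le_square_iff abs_of_pos)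
    \<comment> \<open>As \<open>Re z \<ge> 0\<close>, one factor may be enlarged to
      \<open>R + Re z\<close>, and the product is the square of \<open>Im z\<close>. So the arc
      stays within \<open>d\<close> of \<open>R\<close> also in the real direction, hence within
      \<open>3 * d\<close> of the pole.\<close>
    have "(R - Re z)\<^sup>2 \<le> (R - Re z) * (R + Re z)"
      using rz z(3) R unfolding power2_eq_square by (intro mult_left_mono) auto
    also have "\<dots> = (Im z)\<^sup>2" using z2 by (simp add: power2_eq_square algebra_simps)
    also have "\<dots> \<le> d\<^sup>2" by (rule iz)
    finally have "R - Re z \<le> d" using d by (metis abs_le_square_iff abs_of_pos abs_le_D1)
    then have "0 \<le> \<rho> - Re z" "\<rho> - Re z \<le> 2 * d" using rz d by (auto simp: \<rho>_def)
    then have "(\<rho> - Re z)\<^sup>2 \<le> (2 * d)\<^sup>2" by (intro power_mono) auto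
    then have "(\<rho> - Re z)\<^sup>2 \<le> 4 * d\<^sup>2" by (simp add: power_mult_distrib)
    then have den: "(norm (of_real \<rho> - z))\<^sup>2 \<le> 9 * d\<^sup>2"
      using iz zero_le_power2[of d]
      by (simp only: cmod_power2 minus_complex.sel Re_complex_of_real Im_complex_of_real diff_0 power2_minus)
    have "\<rho>\<^sup>2 - (norm z)\<^sup>2 \<ge> 2 * R * d" using z d by (simp add: \<rho>_def power2_eq_square algebra_simps)
    moreover have "0 \<le> \<rho>\<^sup>2 - (norm z)\<^sup>2" using \<rho> z R by (simp add: power_mono)
    ultimately have "2 * R * d / (9 * d\<^sup>2) \<le> Re (P z)"
      unfolding ReP[OF eq_refl[OF z(1)]] using den R d nz[of z] z
      by (intro frac_le) auto
    then show ?thesis using d by (simp add: power2_eq_square)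
  qed
  have cd: "c * (2 * R / (9 * d)) = p"
    using b R p by (simp add: c_def d_def field_simps power2_eq_square)
  have ReQ_arc: "c * Re (Q z) \<ge> p" if z: "norm z = R" "\<bar>Im z\<bar> \<le> d" for z
  proof -
    have "2 * R / (9 * d) \<le> Re (Q z)"
    proof (cases "Re z \<ge> 0")
      case True
      then show ?thesis using ReP_arc[of z] ReP0[of "-z"] z by (simp add: Q_def)
    next
      case False
      then show ?thesis using ReP_arc[of "-z"] ReP0[of "z"] z by (simp add: Q_def)
    qed
    then have "c * (2 * R / (9 * d)) \<le> c * Re (Q z)" using c by (intro mult_left_mono) auto
    then show ?thesis by (simp only: cd)
  qed
  define \<Psi> where "\<Psi> = (\<lambda>z. G z * H z * exp (- of_real c * Q z))"
  have n\<Psi>: "norm (\<Psi> z) = norm (G z) * norm (H z) * exp (- c * Re (Q z))" for z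
    by (simp add: \<Psi>_def norm_mult)
  have holQ: "Q holomorphic_on cball 0 R"
    unfolding Q_def P_def using nz by (intro holomorphic_intros) auto
  have holC: "(\<lambda>z. G z) holomorphic_on cball 0 R - K" "(\<lambda>z. H z) holomorphic_on cball 0 R - K"
      "Q holomorphic_on cball 0 R - K"
    using G H holQ by (auto intro: holomorphic_on_subset)
  have hol: "\<Psi> holomorphic_on cball 0 R - K"
    unfolding \<Psi>_def by (intro holomorphic_intros holC)
  have "norm (\<Psi> w) \<le> C"
  proof (rule maximum_modulus_punctured_cball[OF K, where R = R and \<Psi> = \<Psi> and w = w])
    show "\<Psi> holomorphic_on ball 0 R - K" using hol by (rule holomorphic_on_subset) auto
    show "continuous_on (cball 0 R - K) \<Psi>" using hol by (rule holomorphic_on_imp_continuous_on)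
    show "w \<notin> K" "norm w < R" using w R norm_ge_zero[of w] by auto
  next
    fix z :: complex assume z: "norm z = R"
    show "norm (\<Psi> z) \<le> C"
    proof (cases "\<bar>Im z\<bar> \<le> d")
      case True
      have "norm (\<Psi> z) \<le> C * exp p * exp (- p)"
        unfolding n\<Psi> using GC[of z] Hs[OF z] ReQ_arc[OF z True] C by (intro mult_mono) auto
      then show ?thesis by (simp add: mult.assoc flip: exp_add)
    next
      case False
      then have "p \<le> b * \<bar>Im z\<bar>" using b by (simp add: d_def field_simps)
      then have "C * exp (- b * \<bar>Im z\<bar>) \<le> C * exp (- p)"
        using C by (intro mult_left_mono) auto
      then have "norm (G z) \<le> C * exp (- p)" using Gb[of z] by linarith
      then have "norm (\<Psi> z) \<le> C * exp (- p) * exp p * 1"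
        unfolding n\<Psi> using Hs[OF z] ReQ0[of z] C c z by (intro mult_mono) auto
      then show ?thesis by (simp add: mult.assoc flip: exp_add)
    qed
  next
    fix \<zeta> :: complex and e :: real assume \<zeta>: "\<zeta> \<in> K" "norm \<zeta> \<le> R" "e > 0"
    have "isCont H \<zeta>" using holomorphic_on_imp_continuous_on[OF H] by (simp add: continuous_on_eq_continuous_at)
    then have "((\<lambda>z. norm (H z)) \<longlongrightarrow> norm (H \<zeta>)) (at \<zeta> within (cball 0 R - K))"
      by (intro tendsto_norm) (auto simp: isCont_def intro: tendsto_within_subset)
    \<comment> \<open>The denominator \<open>C + 1\<close> covers the case
      \<open>C = 0\<close>.\<close>
    moreover have "norm (H \<zeta>) < 1 + e / (C + 1)"
      using HK[OF \<zeta>(1,2)] \<zeta>(3) C by (smt (verit) divide_pos_pos)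
    ultimately have "\<forall>\<^sub>F z in at \<zeta> within (cball 0 R - K). norm (H z) < 1 + e / (C + 1)"
      by (rule order_tendstoD)
    moreover have "\<forall>\<^sub>F z in at \<zeta> within (cball 0 R - K). z \<in> cball 0 R - K"
      by (auto simp: eventually_at_filter)
    ultimately show "\<forall>\<^sub>F z in at \<zeta> within (cball 0 R - K). norm (\<Psi> z) < C + e"
    proof eventually_elim
      case (elim z)
      have "norm (\<Psi> z) \<le> C * (1 + e / (C + 1)) * 1"
        unfolding n\<Psi> using GC[of z] ReQ0[of z] C c elim \<zeta> by (intro mult_mono) auto
      also have "\<dots> < C + e" using C \<zeta>(3) by (simp add: field_simps)
      finally show ?case .
    qed
  qed
  moreover have "norm (\<Psi> w) \<ge> norm (G w) * norm (H w) * exp (- c * 8)"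
    unfolding n\<Psi> using ReQ8 c by (intro mult_left_mono) auto
  ultimately have "norm (G w) * norm (H w) * exp (- c * 8) * exp (c * 8) \<le> C * exp (c * 8)"
    by (intro mult_right_mono) auto
  moreover have "c * 8 = 36 * p\<^sup>2 / (b * R)" using b R by (simp add: c_def field_simps)
  ultimately show ?thesis by (simp add: mult.assoc flip: exp_add)
qed

text \<open>Apply the estimate in the slit disc to \<open>H n ^ M\<close>, with
  \<open>p = M * R n powr (1/4)\<close>. The exponent lost is of order \<open>p^2 / R n\<close>,
  that is \<open>M^2 * R n powr (- 1/2)\<close>, and tends to 0 for fixed \<open>M\<close>; so
  \<open>norm (G w) * h ^ M \<le> C\<close> for all positive \<open>M\<close>, while
  \<open>h ^ M\<close> is unbounded.\<close>

lemma vanishes_off_slits: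
  fixes G :: "complex \<Rightarrow> complex" and H :: "nat \<Rightarrow> complex \<Rightarrow> complex" and R :: "nat \<Rightarrow> real"
  assumes K: "closed K" and G: "G holomorphic_on -K"
    and Gb: "\<And>z. norm (G z) \<le> C * exp (- b * \<bar>Im z\<bar>)" and b: "b > 0"
    and R: "filterlim R at_top sequentially"
    and H: "\<And>n. H n holomorphic_on UNIV"
    and Hs: "\<And>n z. norm z = R n \<Longrightarrow> norm (H n z) \<le> exp (R n powr (1/4))"
    and HK: "\<And>n z. z \<in> K \<Longrightarrow> norm z \<le> R n \<Longrightarrow> norm (H n z) \<le> 1"
    and h: "h > 1" "\<And>n. norm (H n w) \<ge> h"
    and w: "w \<notin> K"
  shows "G w = 0"
proof (rule ccontr)
  assume "G w \<noteq> 0"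
  have bound: "norm (G w) * h ^ M \<le> C" if M: "M > 0" for M :: nat
  proof -
    define g where "g = (\<lambda>x. C * exp (36 * (real M * x powr (1/4))\<^sup>2 / (b * x)))"
    have "(g \<longlongrightarrow> C * exp 0) at_top"
      unfolding g_def using b M by (intro tendsto_intros) real_asymp
    then have "((\<lambda>n. g (R n)) \<longlongrightarrow> C) sequentially"
      using R by (auto dest: filterlim_compose)
    moreover have "\<forall>\<^sub>F n in sequentially. norm (G w) * h ^ M \<le> g (R n)"
    proof -
      have "\<forall>\<^sub>F n in sequentially. 2 * norm w + 1 \<le> R n"
        using R by (auto simp: filterlim_at_top)
      then show ?thesis
      proof eventually_elim
        case (elim n)
        then have Rp: "R n > 0" "2 * norm w \<le> R n" using norm_ge_zero[of w] by linarith+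
        have "norm (G w) * norm (H n w ^ M) \<le> C * exp (36 * (real M * R n powr (1/4))\<^sup>2 / (b * R n))"
        proof (rule norm_le_slit_disc[OF K G Gb b])
          show "(\<lambda>z. H n z ^ M) holomorphic_on UNIV" by (intro holomorphic_intros H)
          show "norm (H n z ^ M) \<le> exp (real M * R n powr (1/4))" if "norm z = R n" for z
            using power_mono[OF Hs[OF that], of M] by (simp add: norm_power exp_of_nat_mult)
          show "norm (H n z ^ M) \<le> 1" if "z \<in> K" "norm z \<le> R n" for z
            using HK[OF that] by (simp add: norm_power power_le_one)
        qed (use M Rp w in auto)
        moreover have "h ^ M \<le> norm (H n w ^ M)"
          unfolding norm_power using h by (intro power_mono) auto
        then have "norm (G w) * h ^ M \<le> norm (G w) * norm (H n w ^ M)"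
          by (rule mult_left_mono) auto
        ultimately show ?case by (simp add: g_def)
      qed
    qed
    ultimately show ?thesis
      by (intro tendsto_lowerbound[of "\<lambda>n. g (R n)"]) auto
  qed
  obtain M where "C / norm (G w) < h ^ M" using real_arch_pow[OF h(1)] by blast
  \<comment> \<open>\<open>bound\<close> asks for a positive exponent.\<close>
  also have "h ^ M \<le> h ^ Suc M" using h by (intro power_increasing) auto
  finally have "C < norm (G w) * h ^ Suc M" using \<open>G w \<noteq> 0\<close> by (simp add: field_simps)
  with bound[of "Suc M"] show False by simp
qed

subsection \<open>Polynomials that are small on a sparse set\<close>

text \<open>A discrete form of integrating \<open>exp (a * S)\<close> with respect to
  \<open>S\<close>, where \<open>S\<close> has the increments \<open>1 / u m\<close>. The terms are
  compared with a telescoping sum; \<open>1 - exp (- y) \<ge> y / 2\<close> for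
  \<open>y = a / u m \<le> 1\<close> costs the factor 2.\<close>

lemma sum_exp_partial_sums_le:
  fixes u :: "nat \<Rightarrow> real"
  assumes u: "\<And>m. n0 \<le> m \<Longrightarrow> a \<le> u m" and a: "a > 0"
  shows "(\<Sum>m=n0..N. exp (a * (\<Sum>j=n0..m. 1 / u j)) / u m) \<le> 2 / a * exp (a * (\<Sum>j=n0..N. 1 / u j))"
proof (induction N)
  case 0
  show ?case
  proof (cases "n0 = 0")
    case True
    then have "1 / u 0 \<le> 2 / a" using u[of 0] a by (intro frac_le) auto
    then have "exp (a * (1 / u 0)) * (1 / u 0) \<le> exp (a * (1 / u 0)) * (2 / a)"
      by (intro mult_left_mono) auto
    then show ?thesis using True by (simp add: mult.commute)
  qed (use a in auto)
next
  case (Suc N)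
  show ?case
  proof (cases "n0 \<le> Suc N")
    case True
    let ?S = "\<lambda>m. \<Sum>j=n0..m. 1 / u j"
    define y where "y = a / u (Suc N)"
    have uN: "u (Suc N) \<ge> a" "u (Suc N) > 0" using u[OF True] a by linarith+
    have y: "0 < y" "y \<le> 1" using uN a by (auto simp: y_def)
    have "(1 - exp (- y)) * 2 \<ge> y"
    proof -
      have "exp (- y) \<le> inverse (1 + y)"
        using exp_ge_add_one_self[of y] y by (simp add: exp_minus le_imp_inverse_le)
      moreover have "inverse (1 + y) \<le> 1 - y / 2"
      proof -
        have "y * y \<le> y * 1" using y by (intro mult_left_mono) auto
        then have "1 \<le> (1 - y / 2) * (1 + y)" by (simp add: algebra_simps)
        then show ?thesis using y by (simp add: field_simps)
      qed
      ultimately have "exp (- y) \<le> 1 - y / 2" by (rule order_trans)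
      moreover have "y \<le> (1 - e) * 2" if "e \<le> 1 - y / 2" for e :: real using that by simp
      ultimately show ?thesis by blast
    qed
    then have "y * exp (a * ?S (Suc N)) \<le> (1 - exp (- y)) * 2 * exp (a * ?S (Suc N))"
      by (intro mult_right_mono) auto
    also have "\<dots> = 2 * exp (a * ?S (Suc N)) - 2 * exp (a * ?S N)"
      using True by (simp add: y_def algebra_simps flip: exp_add)
    finally have "exp (a * ?S (Suc N)) / u (Suc N) \<le> 2 / a * exp (a * ?S (Suc N)) - 2 / a * exp (a * ?S N)"
      using a uN by (simp add: y_def field_simps)
    then show ?thesis using Suc True by simp
  qed (use a in auto)
qed

text \<open>Bounds at modulus about \<open>exp v\<close> a factor whose roots have modulus
  \<open>exp t\<close>. The factor 2 in the assumption admits points slightly beyond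
  \<open>exp v\<close>; \<open>t \<le> v\<close> lets the summand 1 be absorbed, and
  \<open>5 \<le> exp 2\<close>.\<close>

lemma norm_one_minus_square_quotient_le:
  fixes z :: complex
  assumes "norm z \<le> 2 * exp v" "t \<le> v"
  shows "norm (1 - z\<^sup>2 / (of_real (exp t))\<^sup>2) \<le> exp (2 * (1 + v - t))"
proof -
  have "(norm z)\<^sup>2 \<le> (2 * exp v)\<^sup>2" using assms by (intro power_mono) auto
  also have "\<dots> = 4 * exp (2 * v)" by (simp add: power2_eq_square flip: exp_add)
  finally have "(norm z)\<^sup>2 / exp (2 * t) \<le> 4 * exp (2 * v) / exp (2 * t)" by (intro divide_right_mono) auto
  also have "\<dots> = 4 * exp (2 * (v - t))" by (simp add: exp_diff algebra_simps)
  finally have *: "(norm z)\<^sup>2 / exp (2 * t) \<le> 4 * exp (2 * (v - t))" .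
  have "norm (1 - z\<^sup>2 / (of_real (exp t))\<^sup>2) \<le> norm (1::complex) + norm (z\<^sup>2 / (of_real (exp t))\<^sup>2)"
    by (rule norm_triangle_ineq4)
  also have "norm (z\<^sup>2 / (of_real (exp t))\<^sup>2) = (norm z)\<^sup>2 / exp (2 * t)"
    by (simp add: norm_divide norm_power exp_double)
  also have "norm (1::complex) + \<dots> \<le> 1 + 4 * exp (2 * (v - t))" using * by simp
  also have "\<dots> \<le> 5 * exp (2 * (v - t))" using assms by simp
  also have "\<dots> \<le> exp 2 * exp (2 * (v - t))"
    using exp_lower_Taylor_quadratic[of 2] by (intro mult_right_mono) auto
  also have "\<dots> = exp (2 * (1 + v - t))" by (simp add: algebra_simps flip: exp_add)
  finally show ?thesis .
qed

text \<open>Within distance 2 of \<open>l n\<close> the factor with index \<open>n\<close> is at most \<open>exp (- u n / 2)\<close>, and a factor with index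
  \<open>m < n\<close> is at most \<open>exp (2 (1 + u n - u m))\<close>; the later factors are at most 1. So the
  multiplicities have to satisfy \<open>\<Sum>m<n. 2 k m (1 + u n - u m) \<le> k n u n / 2\<close>, and \<open>\<kappa>\<close> is an explicit
  solution of this recursive inequality. It grows like a small power of \<open>l\<close> because
  \<open>S N \<le> u N * (\<Sum>m=n0..N. 1 / (u m)\<^sup>2)\<close>.\<close>

lemma sparse_multiplier_aux:
  fixes l u S \<kappa> :: "nat \<Rightarrow> real" and k :: "nat \<Rightarrow> nat"
  assumes gap: "\<And>m n. 1 \<le> m \<Longrightarrow> m < n \<Longrightarrow> l m + 2 < l n"
    and l1: "\<And>n. 1 \<le> n \<Longrightarrow> l n > 1"
    and u_def: "u = (\<lambda>n. ln (l n))"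
    and n0: "1 \<le> n0" "\<And>m. n0 \<le> m \<Longrightarrow> 128 \<le> u m"
    and tail: "\<And>N. (\<Sum>m=n0..N. 1 / (u m)\<^sup>2) \<le> 1 / 1024"
    and S_def: "S = (\<lambda>m. \<Sum>j=n0..m. 1 / u j)"
    and \<kappa>_def: "\<kappa> = (\<lambda>m. exp (u m / 8 + 128 * S m) / u m)"
    and k_def: "k = (\<lambda>m. nat \<lceil>\<kappa> m\<rceil>)"
    and H_def: "H = (\<lambda>z::complex. \<Prod>m=n0..N. (1 - z\<^sup>2 / (of_real (l m))\<^sup>2) ^ k m)"
    and N: "n0 \<le> N"
  shows "norm z = l N \<Longrightarrow> norm (H z) \<le> exp (l N powr (1/4))"
    and "1 \<le> n \<Longrightarrow> l n - 1 \<le> \<bar>x\<bar> \<Longrightarrow> \<bar>x\<bar> \<le> l n + 2 \<Longrightarrow> \<bar>x\<bar> \<le> l N \<Longrightarrow> norm (H (of_real x)) \<le> 1"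
    and "norm (H (\<i> * of_real y)) \<ge> 1 + y\<^sup>2 / (l n0)\<^sup>2"
proof -
  have mono: "l m \<le> l n" if "1 \<le> m" "m \<le> n" for m n
    using gap[of m n] that by (cases "m = n") auto
  have lexp: "l m = exp (u m)" if "1 \<le> m" for m
    using l1[OF that] by (simp add: u_def)
  have umono: "u m \<le> u n" if "1 \<le> m" "m \<le> n" for m n
    using mono[OF that] l1[of m] that by (simp add: u_def)
  \<comment> \<open>Needed so that rounding \<open>\<kappa> m\<close> up to the integer
    \<open>k m\<close> at most doubles it.\<close>
  have \<kappa>1: "1 \<le> \<kappa> m" if m: "n0 \<le> m" for m
  proof -
    have um: "u m \<ge> 128" using n0(2)[OF m] .
    have S0: "S m \<ge> 0"
      unfolding S_def
    proof (intro sum_nonneg)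
      fix j assume "j \<in> {n0..m}"
      then show "0 \<le> 1 / u j" using n0(2)[of j] by simp
    qed
    have "(u m / 8) * 16 \<le> (u m / 8) * (u m / 8)" using um by (intro mult_left_mono) auto
    then have "u m \<le> 1 + u m / 8 + (u m / 8)\<^sup>2 / 2" using um unfolding power2_eq_square by linarith
    also have "\<dots> \<le> exp (u m / 8)" by (rule exp_lower_Taylor_quadratic) (use um in auto)
    also have "\<dots> \<le> exp (u m / 8 + 128 * S m)" using S0 by simp
    finally show ?thesis using um by (simp add: \<kappa>_def)
  qed
  have k: "\<kappa> m \<le> real (k m)" "real (k m) \<le> 2 * \<kappa> m" "1 \<le> k m" if m: "n0 \<le> m" for m
    using \<kappa>1[OF m] by (simp_all add: k_def) linarith+
  \<comment> \<open>The total exponent of the factors up to index \<open>L\<close> at modulus about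
    \<open>exp v\<close>. With \<open>1 + t \<le> 8 * exp (t / 8)\<close> the term
    \<open>exp (u m / 8)\<close> in \<open>\<kappa> m\<close> cancels, leaving the sum of
    \<open>sum_exp_partial_sums_le\<close> for \<open>a = 128\<close>; this \<open>a\<close> turns
    the constant 32 into \<open>32 * 2 / 128 = 1 / 2\<close>.\<close>
  have key: "(\<Sum>m=n0..L. real (k m) * (2 * (1 + v - u m))) \<le> exp (128 * S L + v / 8) / 2"
    if v: "\<And>m. n0 \<le> m \<Longrightarrow> m \<le> L \<Longrightarrow> u m \<le> v" for L v
  proof -
    have "(\<Sum>m=n0..L. real (k m) * (2 * (1 + v - u m))) \<le>
        (\<Sum>m=n0..L. 32 * exp (v / 8) * (exp (128 * S m) / u m))"
    proof (rule sum_mono)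
      fix m assume "m \<in> {n0..L}"
      then have m: "n0 \<le> m" "m \<le> L" by auto
      have "1 + v - u m \<le> 8 * e" if "1 + (v - u m) / 8 \<le> e" for e :: real using that by argo
      then have "1 + v - u m \<le> 8 * exp ((v - u m) / 8)" using exp_ge_add_one_self by blast
      then have "real (k m) * (2 * (1 + v - u m)) \<le> (2 * \<kappa> m) * (2 * (8 * exp ((v - u m) / 8)))"
        using k[OF m(1)] v[OF m] \<kappa>1[OF m(1)] by (intro mult_mono) auto
      also have "\<dots> = 32 * exp (v / 8) * (exp (128 * S m) / u m)"
        by (simp add: \<kappa>_def exp_add exp_diff diff_divide_distrib)
      finally show "real (k m) * (2 * (1 + v - u m)) \<le> 32 * exp (v / 8) * (exp (128 * S m) / u m)" .
    qed
    also have "\<dots> = 32 * exp (v / 8) * (\<Sum>m=n0..L. exp (128 * S m) / u m)"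
      by (simp add: sum_distrib_left)
    also have "\<dots> \<le> 32 * exp (v / 8) * (2 / 128 * exp (128 * S L))"
      unfolding S_def by (intro mult_left_mono sum_exp_partial_sums_le n0) auto
    also have "\<dots> = exp (128 * S L + v / 8) / 2" by (simp add: exp_add)
    finally show ?thesis .
  qed
  have nH: "norm (H z) = (\<Prod>m=n0..N. norm (1 - z\<^sup>2 / (of_real (l m))\<^sup>2) ^ k m)" for z
    by (simp add: H_def norm_power flip: prod_norm)
  have fac: "norm (1 - z\<^sup>2 / (of_real (l m))\<^sup>2) ^ k m \<le> exp (real (k m) * (2 * (1 + v - u m)))"
    if "norm z \<le> 2 * exp v" "n0 \<le> m" "u m \<le> v" for z :: complex and m v
    using power_mono[OF norm_one_minus_square_quotient_le[OF that(1,3)], of "k m"] n0(1) that(2) lexp[of m]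
    by (simp add: exp_of_nat_mult)

  show "norm (H z) \<le> exp (l N powr (1/4))" if z: "norm z = l N"
  proof -
    have uN: "u m \<le> u N" if "n0 \<le> m" "m \<le> N" for m using umono[of m N] that n0 by auto
    have "norm (H z) \<le> (\<Prod>m=n0..N. exp (real (k m) * (2 * (1 + u N - u m))))"
      unfolding nH using z lexp[of N] n0 N uN by (intro prod_mono conjI fac) auto
    also have "\<dots> = exp (\<Sum>m=n0..N. real (k m) * (2 * (1 + u N - u m)))" by (simp add: exp_sum)
    also have "\<dots> \<le> exp (exp (u N / 4))"
    proof -
      \<comment> \<open>Here the convergence of the series enters: the tail bound
        \<open>1 / 1024\<close> makes \<open>128 * S N\<close> at most \<open>u N / 8\<close>, the
        other half of the exponent \<open>u N / 4\<close>.\<close>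
      have "S N \<le> u N * (\<Sum>m=n0..N. 1 / (u m)\<^sup>2)"
        unfolding S_def sum_distrib_left
      proof (rule sum_mono)
        fix m assume m: "m \<in> {n0..N}"
        then have "u m \<le> u N" "u m > 0" using uN[of m] n0(2)[of m] by auto
        then show "1 / u m \<le> u N * (1 / (u m)\<^sup>2)" by (simp add: field_simps power2_eq_square)
      qed
      also have "\<dots> \<le> u N * (1 / 1024)" using tail[of N] n0(2)[OF N] by (intro mult_left_mono) auto
      finally have "128 * S N + u N / 8 \<le> u N / 4" by simp
      then have "exp (128 * S N + u N / 8) / 2 \<le> exp (u N / 4)"
        using exp_gt_zero[of "u N / 4"] by (smt (verit) exp_le_cancel_iff field_sum_of_halves)
      moreover have "(\<Sum>m=n0..N. real (k m) * (2 * (1 + u N - u m))) \<le> exp (128 * S N + u N / 8) / 2"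
        by (rule key) (rule uN)
      ultimately show ?thesis by simp
    qed
    also have "exp (u N / 4) = l N powr (1/4)" using l1[of N] n0 N by (simp add: powr_def u_def)
    finally show ?thesis .
  qed

  show "norm (H (of_real x)) \<le> 1" if n: "1 \<le> n" and x: "l n - 1 \<le> \<bar>x\<bar>" "\<bar>x\<bar> \<le> l n + 2" "\<bar>x\<bar> \<le> l N"
  proof -
    have nN: "n \<le> N" using gap[of N n] n0 N x by (cases "N < n") auto
    have later: "norm (1 - (of_real x)\<^sup>2 / (of_real (l m))\<^sup>2 :: complex) ^ k m \<le> 1" if m: "n < m" "n0 \<le> m" for m
    proof -
      have "\<bar>x\<bar> \<le> l m" "l m > 1" using gap[OF n m(1)] x l1[of m] n m by auto
      then have "x\<^sup>2 / (l m)\<^sup>2 \<le> 1" by (simp add: abs_le_square_iff[symmetric])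
      then have "\<bar>1 - x\<^sup>2 / (l m)\<^sup>2\<bar> \<le> 1" by (simp add: abs_if)
      moreover have "(1 - (of_real x)\<^sup>2 / (of_real (l m))\<^sup>2 :: complex) = of_real (1 - x\<^sup>2 / (l m)\<^sup>2)" by simp
      ultimately have "norm (1 - (of_real x)\<^sup>2 / (of_real (l m))\<^sup>2 :: complex) \<le> 1" by (simp only: norm_of_real)
      then show ?thesis by (simp add: power_le_one)
    qed
    show ?thesis
    proof (cases "n0 \<le> n")
      \<comment> \<open>For \<open>n < n0\<close> there are no roots near \<open>x\<close>, but
        every factor of the product has a later index.\<close>
      case False
      then show ?thesis unfolding nH by (intro prod_le_1 conjI later) auto
    next
      case True
      have un: "u n \<ge> 128" using n0(2)[OF True] .
      \<comment> \<open>The square of 6: near \<open>l n\<close> the factor is at most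
        \<open>6 / l n\<close>, and \<open>6 \<le> exp (u n / 2)\<close> turns this into
        \<open>exp (- u n / 2)\<close>.\<close>
      have big: "36 \<le> l n"
      proof -
        have "36 \<le> 1 + u n" using un by simp
        also have "\<dots> \<le> exp (u n)" by (rule exp_ge_add_one_self)
        finally show ?thesis using lexp[OF n] by simp
      qed
      have at: "norm (1 - (of_real x)\<^sup>2 / (of_real (l n))\<^sup>2 :: complex) ^ k n \<le> exp (- (exp (u n / 8 + 128 * S n) / 2))"
      proof -
        have ln0: "l n > 0" using big by simp
        have "\<bar>(l n)\<^sup>2 - x\<^sup>2\<bar> = \<bar>l n - \<bar>x\<bar>\<bar> * \<bar>l n + \<bar>x\<bar>\<bar>"
          by (simp add: abs_mult[symmetric] algebra_simps power2_eq_square)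
        also have "\<dots> \<le> 2 * (3 * l n)" using x big by (intro mult_mono) auto
        finally have "\<bar>(l n)\<^sup>2 - x\<^sup>2\<bar> / (l n)\<^sup>2 \<le> 2 * (3 * l n) / (l n)\<^sup>2" by (intro divide_right_mono) auto
        also have "\<dots> = 6 / l n" using ln0 by (simp add: power2_eq_square)
        also have "\<dots> \<le> exp (- u n / 2)"
        proof -
          have "6\<^sup>2 \<le> (exp (u n / 2))\<^sup>2"
            using big lexp[OF n] by (simp add: power2_eq_square flip: exp_add)
          then have "6 \<le> exp (u n / 2)" using power2_le_imp_le exp_ge_zero by blast
          then have "6 / l n \<le> exp (u n / 2) / l n" using ln0 by (intro divide_right_mono) auto
          also have "\<dots> = exp (- u n / 2)" by (simp add: lexp[OF n] flip: exp_diff)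
          finally show ?thesis .
        qed
        finally have "\<bar>(l n)\<^sup>2 - x\<^sup>2\<bar> / (l n)\<^sup>2 \<le> exp (- u n / 2)" .
        moreover have "(1 - (of_real x)\<^sup>2 / (of_real (l n))\<^sup>2 :: complex) = of_real (((l n)\<^sup>2 - x\<^sup>2) / (l n)\<^sup>2)"
          using ln0 by (simp add: field_simps)
        ultimately have "norm (1 - (of_real x)\<^sup>2 / (of_real (l n))\<^sup>2 :: complex) \<le> exp (- u n / 2)"
          by (simp only: norm_of_real abs_divide) simp
        then have "norm (1 - (of_real x)\<^sup>2 / (of_real (l n))\<^sup>2 :: complex) ^ k n \<le> exp (- u n / 2) ^ k n"
          by (intro power_mono) auto
        also have "\<dots> = exp (- (real (k n) * u n / 2))" by (simp flip: exp_of_nat_mult)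
        also have "\<dots> \<le> exp (- (\<kappa> n * u n / 2))" using k[OF True] un by simp
        also have "\<kappa> n * u n = exp (u n / 8 + 128 * S n)" using un by (simp add: \<kappa>_def)
        finally show ?thesis .
      qed
      \<comment> \<open>This is \<open>key\<close> with \<open>v = u n\<close> and
        \<open>L = n - 1\<close>. The bound is the reciprocal of the one in \<open>at\<close>,
        because the denominator in \<open>\<kappa> n\<close> makes \<open>\<kappa> n * u n\<close>
        equal to \<open>exp (u n / 8 + 128 * S n)\<close>.\<close>
      have before: "(\<Prod>m\<in>{n0..<n}. norm (1 - (of_real x)\<^sup>2 / (of_real (l m))\<^sup>2 :: complex) ^ k m)
          \<le> exp (exp (u n / 8 + 128 * S n) / 2)"
      proof (cases "n0 = n")
        case True
        then show ?thesis by simp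
      next
        case False
        then have n1: "{n0..<n} = {n0..n-1}" "n0 \<le> n - 1" "Suc (n - 1) = n" using \<open>n0 \<le> n\<close> by auto
        have um: "u m \<le> u n" if "n0 \<le> m" "m \<le> n - 1" for m using umono[of m n] that n0 by auto
        have x2: "norm (of_real x :: complex) \<le> 2 * exp (u n)"
          using x big lexp[OF n] by simp
        have "(\<Prod>m\<in>{n0..n-1}. norm (1 - (of_real x)\<^sup>2 / (of_real (l m))\<^sup>2 :: complex) ^ k m)
            \<le> (\<Prod>m\<in>{n0..n-1}. exp (real (k m) * (2 * (1 + u n - u m))))"
          using um x2 by (intro prod_mono conjI fac) auto
        also have "\<dots> = exp (\<Sum>m=n0..n-1. real (k m) * (2 * (1 + u n - u m)))" by (simp add: exp_sum)
        also have "\<dots> \<le> exp (exp (128 * S (n - 1) + u n / 8) / 2)"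
          using key[OF um] by simp
        also have "\<dots> \<le> exp (exp (u n / 8 + 128 * S n) / 2)"
        proof -
          have "S n = S (n - 1) + 1 / u n"
            using n1 unfolding S_def by (metis sum.nat_ivl_Suc' add.commute le_SucI)
          then show ?thesis using un by simp
        qed
        finally show ?thesis using n1 by simp
      qed
      have "norm (H (of_real x)) = (\<Prod>m\<in>{n0..<n}. norm (1 - (of_real x)\<^sup>2 / (of_real (l m))\<^sup>2 :: complex) ^ k m)
          * norm (1 - (of_real x)\<^sup>2 / (of_real (l n))\<^sup>2 :: complex) ^ k n
          * (\<Prod>m\<in>{n<..N}. norm (1 - (of_real x)\<^sup>2 / (of_real (l m))\<^sup>2 :: complex) ^ k m)"
      proof -
        have eq: "{n0..N} = {n0..<n} \<union> insert n {n<..N}" using True nN by auto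
        have "prod g {n0..N} = prod g {n0..<n} * prod g (insert n {n<..N})" for g :: "nat \<Rightarrow> real"
          unfolding eq by (rule prod.union_disjoint) auto
        then show ?thesis unfolding nH by (simp add: mult.assoc)
      qed
      also have "\<dots> \<le> exp (exp (u n / 8 + 128 * S n) / 2) * exp (- (exp (u n / 8 + 128 * S n) / 2)) * 1"
        using before at True by (intro mult_mono prod_le_1 conjI later) (auto intro!: prod_nonneg)
      also have "\<dots> = 1" by (simp add: exp_minus)
      finally show ?thesis .
    qed
  qed

  \<comment> \<open>On the imaginary axis all factors have modulus at least 1, so the factor with
    index \<open>n0\<close> alone gives a bound independent of \<open>N\<close>.\<close>
  show "norm (H (\<i> * of_real y)) \<ge> 1 + y\<^sup>2 / (l n0)\<^sup>2"
  proof -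
    have eq: "norm (1 - (\<i> * of_real y)\<^sup>2 / (of_real (l m))\<^sup>2) = 1 + y\<^sup>2 / (l m)\<^sup>2" for m
    proof -
      have "(1 - (\<i> * of_real y)\<^sup>2 / (of_real (l m))\<^sup>2) = complex_of_real (1 + y\<^sup>2 / (l m)\<^sup>2)"
        by (simp add: power_mult_distrib)
      then show ?thesis by (simp only: norm_of_real) simp
    qed
    have ge1: "1 \<le> (1 + y\<^sup>2 / (l m)\<^sup>2) ^ k m" for m by (intro one_le_power) auto
    have "1 + y\<^sup>2 / (l n0)\<^sup>2 \<le> (1 + y\<^sup>2 / (l n0)\<^sup>2) ^ k n0 * 1"
      using power_increasing[of 1 "k n0" "1 + y\<^sup>2 / (l n0)\<^sup>2"] k(3)[of n0] by simp
    also have "\<dots> \<le> (1 + y\<^sup>2 / (l n0)\<^sup>2) ^ k n0 * (\<Prod>m\<in>{n0<..N}. (1 + y\<^sup>2 / (l m)\<^sup>2) ^ k m)"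
      using ge1 by (intro mult_left_mono prod_ge_1) auto
    also have "\<dots> = (\<Prod>m\<in>{n0..N}. (1 + y\<^sup>2 / (l m)\<^sup>2) ^ k m)"
    proof -
      have "{n0..N} = insert n0 {n0<..N}" using N by auto
      then show ?thesis by simp
    qed
    finally show ?thesis unfolding nH eq .
  qed
qed

text \<open>It remains to choose \<open>n0\<close> so far out that the tail of the series is small.
  The last bound does not depend on \<open>n\<close>, which makes it usable as \<open>h\<close> in
  \<open>vanishes_off_slits\<close>.\<close>

lemma sparse_multiplier:
  fixes l :: "nat \<Rightarrow> real"
  assumes l1: "\<And>n. n \<ge> 1 \<Longrightarrow> l n > 1"
    and sep: "\<And>n. n \<ge> 1 \<Longrightarrow> l n * (1 + 1 / ln (l n)) < l (n + 1) * (1 - 1 / ln (l (n + 1)))"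
    and sm: "(\<lambda>n. 1 / (ln (l n))\<^sup>2) summable_on {1..}"
  obtains n0 and H :: "nat \<Rightarrow> complex \<Rightarrow> complex" where "n0 \<ge> 1"
    and "filterlim (\<lambda>n. l (n + n0)) at_top sequentially"
    and "\<And>n. H n holomorphic_on UNIV"
    and "\<And>n z. norm z = l (n + n0) \<Longrightarrow> norm (H n z) \<le> exp (l (n + n0) powr (1/4))"
    and "\<And>n m x. 1 \<le> m \<Longrightarrow> l m - 1 \<le> \<bar>x\<bar> \<Longrightarrow> \<bar>x\<bar> \<le> l m + 2 \<Longrightarrow> \<bar>x\<bar> \<le> l (n + n0)
           \<Longrightarrow> norm (H n (of_real x)) \<le> 1"
    and "\<And>n y. norm (H n (\<i> * of_real y)) \<ge> 1 + y\<^sup>2 / (l n0)\<^sup>2"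
proof -
  define u where "u = (\<lambda>n. ln (l n))"
  \<comment> \<open>From \<open>ln x \<le> x - 1\<close>, both correction terms
    \<open>l n / ln (l n)\<close> in the separation condition are at least 1.\<close>
  have gap1: "l n + 2 < l (Suc n)" if n: "1 \<le> n" for n
  proof -
    have *: "1 \<le> l m / ln (l m)" if "1 \<le> m" for m
      using l1[OF that] ln_le_minus_one[of "l m"] by (simp add: field_simps)
    have "l n * (1 + 1 / ln (l n)) = l n + l n / ln (l n)" by (simp add: algebra_simps)
    moreover have "l (n+1) * (1 - 1 / ln (l (n+1))) = l (n+1) - l (n+1) / ln (l (n+1))" by (simp add: algebra_simps)
    ultimately show ?thesis using sep[OF n] *[OF n] *[of "n+1"] by simp
  qed
  have gap: "l m + 2 < l n" if "1 \<le> m" "m < n" for m n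
    using that(2) that(1)
  proof (induction n)
    case (Suc n)
    then show ?case using gap1[of n] by (cases "m = n") auto
  qed auto
  \<comment> \<open>Index 0 is masked, since \<open>l 0\<close> is arbitrary.\<close>
  have "(\<lambda>n. if n \<in> {1..} then 1 / (u n)\<^sup>2 else 0) summable_on UNIV"
    using sm summable_on_cong_neutral[of UNIV "{1..}" "\<lambda>n. if n \<in> {1..} then 1 / (u n)\<^sup>2 else 0"
        "\<lambda>n. 1 / (ln (l n))\<^sup>2"] by (simp add: u_def)
  then have "summable (\<lambda>n. if n \<in> {1..} then 1 / (u n)\<^sup>2 else 0)"
    by (subst (asm) summable_on_UNIV_nonneg_real_iff) auto
  \<comment> \<open>The threshold serves twice: it bounds the tail sums by \<open>1 / 1024\<close>,
    and applied to a single term it forces \<open>u m > 128\<close>.\<close>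
  then obtain n1 where n1: "\<And>m n. m \<ge> n1 \<Longrightarrow> norm (\<Sum>j\<in>{m..<n}. if j \<in> {1..} then 1 / (u j)\<^sup>2 else 0) < 1 / 128\<^sup>2"
    unfolding summable_Cauchy by (metis zero_less_divide_1_iff zero_less_numeral zero_less_power)
  define n0 where "n0 = Suc n1"
  have n0: "n0 \<ge> 1" by (simp add: n0_def)
  have tail: "(\<Sum>j=m..N. 1 / (u j)\<^sup>2) < 1 / 128\<^sup>2" if m: "m \<ge> n0" for m N
  proof -
    have "(\<Sum>j=m..N. 1 / (u j)\<^sup>2) = (\<Sum>j\<in>{m..<Suc N}. if j \<in> {1..} then 1 / (u j)\<^sup>2 else 0)"
      using m n0 by (intro sum.cong) auto
    also have "\<dots> \<le> norm \<dots>" unfolding real_norm_def by (rule abs_ge_self)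
    also have "\<dots> < 1 / 128\<^sup>2" by (rule n1) (use m in \<open>simp add: n0_def\<close>)
    finally show ?thesis .
  qed
  have u128: "128 \<le> u m" if m: "n0 \<le> m" for m
  proof -
    have u0: "u m > 0" using l1[of m] m n0 by (simp add: u_def)
    have "1 / (u m)\<^sup>2 < 1 / 128\<^sup>2" using tail[of m m] m by simp
    then have "128\<^sup>2 < (u m)\<^sup>2" using u0 by (simp add: field_simps)
    then show ?thesis using u0 by (smt (verit) power2_less_imp_less)
  qed
  define S where "S = (\<lambda>m. \<Sum>j=n0..m. 1 / u j)"
  define \<kappa> where "\<kappa> = (\<lambda>m. exp (u m / 8 + 128 * S m) / u m)"
  define k where "k = (\<lambda>m. nat \<lceil>\<kappa> m\<rceil>)"
  define H where "H = (\<lambda>N. \<lambda>z::complex. \<Prod>m=n0..N+n0. (1 - z\<^sup>2 / (of_real (l m))\<^sup>2) ^ k m)"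
  have t: "(\<Sum>m=n0..N. 1 / (u m)\<^sup>2) \<le> 1 / 1024" for N
    using tail[of n0 N] by simp
  note aux = sparse_multiplier_aux[OF _ _ u_def n0 _ _ S_def \<kappa>_def k_def fun_cong[OF H_def]]
  show ?thesis
  proof (rule that[of n0 H])
    show "n0 \<ge> 1" by (rule n0)
    have lb: "real n \<le> l (n + n0)" for n
    proof (induction n)
      case (Suc n)
      then show ?case using gap1[of "n + n0"] n0 by simp
    qed (use l1[of n0] n0 in simp)
    show "filterlim (\<lambda>n. l (n + n0)) at_top sequentially"
      by (rule filterlim_at_top_mono[OF filterlim_real_sequentially]) (use lb in simp)
    show "H n holomorphic_on UNIV" for n
      unfolding H_def
    proof (intro holomorphic_intros)
      fix m assume "m \<in> {n0..n + n0}"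
      then have "l m \<noteq> 0" using l1[of m] n0 by auto
      then show "(complex_of_real (l m))\<^sup>2 \<noteq> 0" by simp
    qed
    show "norm (H n z) \<le> exp (l (n + n0) powr (1/4))" if "norm z = l (n + n0)" for n z
      by (rule aux(1)) (use t in \<open>simp_all add: gap l1 u128 that\<close>)
    show "norm (H n (of_real x)) \<le> 1"
      if "1 \<le> m" "l m - 1 \<le> \<bar>x\<bar>" "\<bar>x\<bar> \<le> l m + 2" "\<bar>x\<bar> \<le> l (n + n0)" for n m x
      by (rule aux(2)[where n = m]) (use t that(1) in \<open>simp_all add: gap l1 u128 that\<close>)
    show "norm (H n (\<i> * of_real y)) \<ge> 1 + y\<^sup>2 / (l n0)\<^sup>2" for n y
      by (rule aux(3)) (use t in \<open>simp_all add: gap l1 u128\<close>)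
  qed
qed

subsection \<open>The Fourier transform on integrable and square integrable functions\<close>

text \<open>By Levy's uniqueness theorem: the positive and the negative part of \<open>r\<close>
  have equal mass \<open>m\<close> (take \<open>t = 0\<close>) and, divided by \<open>m > 0\<close>,
  are densities of two distributions with the same characteristic function.\<close>

lemma AE_zero_if_char_integral_zero:
  fixes r :: "real \<Rightarrow> real"
  assumes r: "integrable lborel r"
    and zero: "\<And>t. (CLINT x|lborel. r x *\<^sub>R iexp (t * x)) = 0"
  shows "AE x in lborel. r x = 0"
proof -
  define p where "p = (\<lambda>x. max 0 (r x))"
  define n where "n = (\<lambda>x. max 0 (- r x))"
  have rpn: "r x = p x - n x" for x by (auto simp: p_def n_def max_def)
  have pn0: "p x \<ge> 0" "n x \<ge> 0" for x by (auto simp: p_def n_def)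
  have int_p: "integrable lborel p" and int_n: "integrable lborel n"
    unfolding p_def n_def using r by (auto intro!: integrable_max)
  have [measurable]: "p \<in> borel_measurable borel" "n \<in> borel_measurable borel"
    using borel_measurable_integrable[OF int_p] borel_measurable_integrable[OF int_n] by simp_all
  have iexp_int: "integrable lborel (\<lambda>x. q x *\<^sub>R iexp (t * x))" if "integrable lborel q" for q t
    by (rule Bochner_Integration.integrable_bound[OF that]) (use that in auto)
  have eq: "(CLINT x|lborel. p x *\<^sub>R iexp (t * x)) = (CLINT x|lborel. n x *\<^sub>R iexp (t * x))" for t
    using zero[of t] iexp_int[OF int_p] iexp_int[OF int_n]
    by (simp add: rpn scaleR_left_diff_distrib)
  define m where "m = (\<integral>x. p x \<partial>lborel)"
  have "complex_of_real (\<integral>x. p x \<partial>lborel) = complex_of_real (\<integral>x. n x \<partial>lborel)"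
    using eq[of 0] by (simp add: scaleR_conv_of_real)
  then have m: "m = (\<integral>x. n x \<partial>lborel)" unfolding m_def of_real_eq_iff .
  have "m \<ge> 0" unfolding m_def by (intro integral_nonneg_AE) (use pn0 in auto)
  have "AE x in lborel. p x = n x"
  proof (cases "m = 0")
    case True
    have "AE x in lborel. p x = 0"
      using True pn0 by (subst integral_nonneg_eq_0_iff_AE[OF int_p, symmetric]) (auto simp: m_def)
    moreover have "AE x in lborel. n x = 0"
      using True pn0 by (subst integral_nonneg_eq_0_iff_AE[OF int_n, symmetric]) (auto simp: m)
    ultimately show ?thesis by eventually_elim simp
  next
    case False
    then have m0: "m > 0" using \<open>m \<ge> 0\<close> by simp
    define D where "D = (\<lambda>q::real \<Rightarrow> real. density lborel (\<lambda>x. ennreal (q x / m)))"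
    have dist: "real_distribution (D q)"
      if q: "integrable lborel q" "\<And>x. q x \<ge> 0" "m = (\<integral>x. q x \<partial>lborel)" for q
    proof -
      have [measurable]: "q \<in> borel_measurable borel" using borel_measurable_integrable[OF q(1)] by simp
      have "emeasure (D q) (space (D q)) = (\<integral>\<^sup>+x. ennreal (q x / m) \<partial>lborel)"
        by (simp add: D_def emeasure_density)
      also have "\<dots> = ennreal (\<integral>x. q x / m \<partial>lborel)"
        using q m0 by (intro nn_integral_eq_integral) auto
      also have "(\<integral>x. q x / m \<partial>lborel) = 1" using q(3) m0 by simp
      finally show ?thesis
        unfolding real_distribution_def real_distribution_axioms_def
        by (auto intro!: prob_spaceI simp: D_def)
    qed
    have charD: "char (D q) t = (CLINT x|lborel. q x *\<^sub>R iexp (t * x)) / of_real m"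
      if q: "integrable lborel q" "\<And>x. q x \<ge> 0" for q t
    proof -
      have [measurable]: "q \<in> borel_measurable borel" using borel_measurable_integrable[OF q(1)] by simp
      have "char (D q) t = (CLINT x|lborel. (q x / m) *\<^sub>R iexp (t * x))"
        unfolding char_def D_def using m0 q by (subst integral_density) auto
      also have "\<dots> = (CLINT x|lborel. q x *\<^sub>R iexp (t * x) / of_real m)"
        by (simp add: scaleR_conv_of_real field_simps)
      finally show ?thesis by simp
    qed
    have "D p = D n"
    proof (rule Levy_uniqueness)
      show "real_distribution (D p)" using int_p pn0 by (intro dist) (auto simp: m_def)
      show "real_distribution (D n)" using int_n pn0 m by (intro dist) auto
      show "char (D p) = char (D n)"
        using eq by (auto simp: charD int_p int_n pn0)
    qed
    then have "AE x in lborel. ennreal (p x / m) = ennreal (n x / m)"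
      unfolding D_def by (intro sigma_finite_measure.density_unique[OF sigma_finite_lborel]) auto
    then show ?thesis using m0 pn0 by (auto simp: ennreal_inj)
  qed
  then show ?thesis by (simp add: rpn)
qed

lemma borel_measurable_lebesgue_of_real: "complex_of_real \<in> borel_measurable lebesgue"
  by (rule measurable_completion) simp

lemma fourier_L1_integrable:
  assumes "integrable lebesgue g"
  shows "integrable lebesgue (\<lambda>x. g x * exp (- 2 * of_real pi * \<i> * of_real x * of_real \<xi>))"
proof -
  have [measurable]: "g \<in> borel_measurable lebesgue" using assms by auto
  note borel_measurable_lebesgue_of_real [measurable]
  show ?thesis
    by (rule Bochner_Integration.integrable_bound[OF assms]) (auto simp: norm_mult)
qed

text \<open>Conjugating \<open>g\<close> conjugates and reflects its transform, so
  \<open>(g + cnj g) / 2\<close> also has transform 0. A Borel representative \<open>r\<close> of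
  \<open>Re g\<close> reduces this to the real case. Applied to \<open>- \<i> * g\<close>, the lemma
  gives the imaginary part.\<close>

lemma fourier_L1_zero_imp_AE_Re_zero:
  assumes g: "integrable lebesgue g" and zero: "\<And>\<xi>. fourier_L1 g \<xi> = 0"
  shows "AE x in lebesgue. Re (g x) = 0"
proof -
  have int: "integrable lebesgue (\<lambda>x. g x * iexp (t * x))" for t
    \<comment> \<open>This frequency turns the Fourier kernel into
      \<open>iexp (t * x)\<close>.\<close>
    using fourier_L1_integrable[OF g, of "- t / (2 * pi)"] by (simp add: mult_ac)
  have z: "(CLINT x|lebesgue. g x * iexp (t * x)) = 0" for t
    using zero[of "- t / (2 * pi)"] by (simp add: fourier_L1_def mult_ac)
  have zc: "(CLINT x|lebesgue. cnj (g x * iexp (- t * x))) = 0" for t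
    using Bochner_Integration.integral_cnj[of lebesgue "\<lambda>x. g x * iexp (- t * x)"] z[of "- t"] by (simp only: complex_cnj_zero)
  obtain r where r[measurable]: "r \<in> borel_measurable lborel" and rg: "AE x in lborel. Re (g x) = r x"
    using completion_ex_borel_measurable_real[of "\<lambda>x. Re (g x)" lborel] g by auto
  have rg': "AE x in lebesgue. Re (g x) = r x" using rg by (rule AE_completion)
  have "integrable lebesgue r"
    using g rg' by (subst integrable_cong_AE[of _ _ "\<lambda>x. Re (g x)"]) (auto intro: measurable_completion)
  then have ir: "integrable lborel r" by (simp add: integrable_completion)
  have "AE x in lborel. r x = 0"
  proof (rule AE_zero_if_char_integral_zero[OF ir])
    fix t
    have "(CLINT x|lborel. r x *\<^sub>R iexp (t * x)) = (CLINT x|lebesgue. r x *\<^sub>R iexp (t * x))"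
      by (rule integral_completion[symmetric]) measurable
    also have "\<dots> = (CLINT x|lebesgue. Re (g x) *\<^sub>R iexp (t * x))"
    proof (rule integral_cong_AE)
      show "(\<lambda>x. r x *\<^sub>R iexp (t * x)) \<in> borel_measurable lebesgue"
        by (rule measurable_completion) measurable
      have "g \<in> borel_measurable lebesgue" using g by auto
      moreover have "(\<lambda>x. iexp (t * x)) \<in> borel_measurable lebesgue"
        by (rule measurable_completion) simp
      ultimately show "(\<lambda>x. Re (g x) *\<^sub>R iexp (t * x)) \<in> borel_measurable lebesgue" by measurable
      show "AE x in lebesgue. r x *\<^sub>R iexp (t * x) = Re (g x) *\<^sub>R iexp (t * x)"
        using rg' by eventually_elim simp
    qed
    also have "\<dots> = (CLINT x|lebesgue. (g x * iexp (t * x) + cnj (g x * iexp (- t * x))) / 2)"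
    proof (rule Bochner_Integration.integral_cong[OF refl])
      fix x
      have "cnj (g x * iexp (- t * x)) = cnj (g x) * iexp (t * x)" by (simp add: exp_cnj)
      then have "g x * iexp (t * x) + cnj (g x * iexp (- t * x)) = (g x + cnj (g x)) * iexp (t * x)"
        by (simp add: algebra_simps)
      then show "Re (g x) *\<^sub>R iexp (t * x) = (g x * iexp (t * x) + cnj (g x * iexp (- t * x))) / 2"
        by (simp add: complex_add_cnj scaleR_conv_of_real)
    qed
    also have "\<dots> = ((CLINT x|lebesgue. g x * iexp (t * x)) + (CLINT x|lebesgue. cnj (g x * iexp (- t * x)))) / 2"
      by (simp only: integral_divide_zero
          Bochner_Integration.integral_add[OF int Bochner_Integration.integrable_cnj[OF int]])
    also have "\<dots> = 0" by (simp only: z zc) simp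
    finally show "(CLINT x|lborel. r x *\<^sub>R iexp (t * x)) = 0" .
  qed
  then have "AE x in lebesgue. r x = 0" by (rule AE_completion)
  with rg' show ?thesis by eventually_elim simp
qed

lemma fourier_L1_zero_imp_AE_zero:
  assumes g: "integrable lebesgue g" and zero: "\<And>\<xi>. fourier_L1 g \<xi> = 0"
  shows "AE x in lebesgue. g x = 0"
proof -
  have "AE x in lebesgue. Re (- \<i> * g x) = 0"
  proof (rule fourier_L1_zero_imp_AE_Re_zero)
    show "integrable lebesgue (\<lambda>x. - \<i> * g x)" using g by simp
    show "fourier_L1 (\<lambda>x. - \<i> * g x) \<xi> = 0" for \<xi>
      using zero[of \<xi>] by (simp add: fourier_L1_def mult.assoc)
  qed
  moreover have "AE x in lebesgue. Re (g x) = 0"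
    using assms by (rule fourier_L1_zero_imp_AE_Re_zero)
  ultimately show ?thesis by eventually_elim (simp add: complex_eq_iff)
qed

section \<open>The multiplication formula and limits in mean square\<close>

lemma sigma_finite_lebesgue: "sigma_finite_measure (lebesgue :: real measure)"
proof -
  obtain A :: "real set set" where A: "countable A" "A \<subseteq> sets lborel" "\<Union>A = space lborel" "\<forall>a\<in>A. emeasure lborel a \<noteq> \<infinity>"
    using lborel.sigma_finite_countable by blast
  show ?thesis
    by standard (rule exI[of _ A], use A in auto)
qed

text \<open>Fubini for \<open>k\<close>, whose modulus is the integrable product of
  \<open>norm (g x)\<close> and \<open>norm (h y)\<close>. With an indicator for \<open>h\<close> it
  takes the place of Parseval's formula.\<close>

lemma fourier_L1_multiplication_formula:
  assumes g: "integrable lebesgue g" and h: "integrable lebesgue h"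
  shows "(\<integral>x. g x * fourier_L1 h x \<partial>lebesgue) = (\<integral>x. fourier_L1 g x * h x \<partial>lebesgue)"
proof -
  interpret L: sigma_finite_measure "lebesgue :: real measure" by (rule sigma_finite_lebesgue)
  interpret P: pair_sigma_finite "lebesgue :: real measure" "lebesgue :: real measure" ..
  have [measurable]: "g \<in> borel_measurable lebesgue" "h \<in> borel_measurable lebesgue" using g h by auto
  note borel_measurable_lebesgue_of_real [measurable]
  define k where "k = (\<lambda>x y. g x * h y * exp (- 2 * of_real pi * \<i> * of_real x * of_real y))"
  have k_meas [measurable]: "case_prod k \<in> borel_measurable (lebesgue \<Otimes>\<^sub>M lebesgue)"
    unfolding k_def by measurable
  have nk: "norm (k x y) = norm (g x) * norm (h y)" for x y by (simp add: k_def norm_mult)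
  have "integrable (lebesgue \<Otimes>\<^sub>M lebesgue) (case_prod k)"
  proof (rule P.Fubini_integrable[OF k_meas])
    show "integrable lebesgue (\<lambda>x. \<integral>y. norm (case_prod k (x, y)) \<partial>lebesgue)"
      using g by (simp add: nk)
    show "AE x in lebesgue. integrable lebesgue (\<lambda>y. case_prod k (x, y))"
    proof (intro AE_I2)
      fix x :: real
      have "integrable lebesgue (\<lambda>y. g x * (h y * exp (- 2 * of_real pi * \<i> * of_real y * of_real x)))"
        by (intro integrable_mult_right fourier_L1_integrable h)
      then show "integrable lebesgue (\<lambda>y. case_prod k (x, y))" by (simp add: k_def mult_ac)
    qed
  qed
  from P.Fubini_integral[OF this]
  have "(\<integral>y. (\<integral>x. k x y \<partial>lebesgue) \<partial>lebesgue) = (\<integral>x. (\<integral>y. k x y \<partial>lebesgue) \<partial>lebesgue)" .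
  moreover have "(\<integral>x. k x y \<partial>lebesgue) = fourier_L1 g y * h y" for y
  proof -
    have "(\<integral>x. k x y \<partial>lebesgue) = (\<integral>x. g x * exp (- 2 * of_real pi * \<i> * of_real x * of_real y) * h y \<partial>lebesgue)"
      by (simp add: k_def mult_ac)
    then show ?thesis unfolding fourier_L1_def by (simp only: integral_mult_left_zero)
  qed
  moreover have "(\<integral>y. k x y \<partial>lebesgue) = g x * fourier_L1 h x" for x
  proof -
    have "(\<integral>y. k x y \<partial>lebesgue) = (\<integral>y. g x * (h y * exp (- 2 * of_real pi * \<i> * of_real y * of_real x)) \<partial>lebesgue)"
      by (simp add: k_def mult_ac)
    then show ?thesis unfolding fourier_L1_def by (simp only: integral_mult_right_zero)
  qed
  ultimately show ?thesis by simp
qed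

lemma L2_fun_mult_integrable:
  assumes "L2_fun f" "L2_fun w"
  shows "integrable lebesgue (\<lambda>x. f x * w x)"
proof -
  have [measurable]: "f \<in> borel_measurable lebesgue" "w \<in> borel_measurable lebesgue"
    using assms by (auto simp: L2_fun_def)
  have "integrable lebesgue (\<lambda>x. (norm (f x))\<^sup>2 + (norm (w x))\<^sup>2)"
    using assms by (auto simp: L2_fun_def)
  then show ?thesis
  proof (rule Bochner_Integration.integrable_bound)
    show "AE x in lebesgue. norm (f x * w x) \<le> norm ((norm (f x))\<^sup>2 + (norm (w x))\<^sup>2)"
    proof (intro AE_I2)
      fix x
      have "2 * (norm (f x) * norm (w x)) \<le> (norm (f x))\<^sup>2 + (norm (w x))\<^sup>2"
        using sum_squares_bound[of "norm (f x)" "norm (w x)"] by simp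
      moreover have "0 \<le> norm (f x) * norm (w x)" by simp
      ultimately show "norm (f x * w x) \<le> norm ((norm (f x))\<^sup>2 + (norm (w x))\<^sup>2)"
        unfolding norm_mult real_norm_def by linarith
    qed
  qed simp
qed

text \<open>Cauchy-Schwarz, carried out in \<open>ennreal\<close> because \<open>D k\<close> may be
  infinite for some \<open>k\<close>. Integrability of \<open>h k * w\<close> is assumed instead of
  \<open>L2_fun (h k)\<close> so that transforms known only to be bounded can be inserted.\<close>

lemma L2_tendsto_integral:
  assumes h: "\<And>k. h k \<in> borel_measurable lebesgue" "\<And>k. integrable lebesgue (\<lambda>x. h k x * w x)"
    and f: "L2_fun f" and w: "L2_fun w" and lim: "L2_tendsto h f"
  shows "(\<lambda>k. \<integral>x. h k x * w x \<partial>lebesgue) \<longlonglongrightarrow> (\<integral>x. f x * w x \<partial>lebesgue)"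
proof -
  have [measurable]: "f \<in> borel_measurable lebesgue" "w \<in> borel_measurable lebesgue" "\<And>k. h k \<in> borel_measurable lebesgue"
    using f w h by (auto simp: L2_fun_def)
  define a where "a = (\<lambda>k. norm ((\<integral>x. h k x * w x \<partial>lebesgue) - (\<integral>x. f x * w x \<partial>lebesgue)))"
  define D where "D = (\<lambda>k. \<integral>\<^sup>+x. ennreal ((norm (h k x - f x))\<^sup>2) \<partial>lebesgue)"
  define W where "W = (\<integral>\<^sup>+x. ennreal ((norm (w x))\<^sup>2) \<partial>lebesgue)"
  have W: "W < \<infinity>"
  proof -
    have "W = ennreal (\<integral>x. (norm (w x))\<^sup>2 \<partial>lebesgue)"
      unfolding W_def using w by (intro nn_integral_eq_integral) (auto simp: L2_fun_def)
    then show ?thesis by simp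
  qed
  have le: "ennreal ((a k)\<^sup>2) \<le> W * D k" for k
  proof -
    have int: "integrable lebesgue (\<lambda>x. h k x * w x - f x * w x)"
      using h(2) L2_fun_mult_integrable[OF f w] by auto
    have "a k = norm (\<integral>x. h k x * w x - f x * w x \<partial>lebesgue)"
      unfolding a_def using h(2) L2_fun_mult_integrable[OF f w] by (subst Bochner_Integration.integral_diff) auto
    then have "ennreal (a k) \<le> (\<integral>\<^sup>+x. ennreal (norm (h k x * w x - f x * w x)) \<partial>lebesgue)"
      using integral_norm_bound_ennreal[OF int] by simp
    also have "\<dots> = (\<integral>\<^sup>+x. ennreal (norm (w x)) * ennreal (norm (h k x - f x)) \<partial>lebesgue)"
      by (intro nn_integral_cong)
        (simp add: ennreal_mult[symmetric] norm_mult[symmetric] algebra_simps)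
    finally have "(ennreal (a k))\<^sup>2 \<le> (\<integral>\<^sup>+x. ennreal (norm (w x)) * ennreal (norm (h k x - f x)) \<partial>lebesgue)\<^sup>2"
      by (intro power_mono) auto
    also have "\<dots> \<le> (\<integral>\<^sup>+x. (ennreal (norm (w x)))\<^sup>2 \<partial>lebesgue) * (\<integral>\<^sup>+x. (ennreal (norm (h k x - f x)))\<^sup>2 \<partial>lebesgue)"
      by (rule Cauchy_Schwarz_nn_integral) measurable
    also have "\<dots> = W * D k" by (simp add: W_def D_def ennreal_power)
    finally show ?thesis by (simp add: ennreal_power a_def)
  qed
  have "D \<longlonglongrightarrow> 0" using lim by (simp add: L2_tendsto_def D_def)
  then have "(\<lambda>k. W * D k) \<longlonglongrightarrow> W * 0" by (rule ennreal_tendsto_cmult[OF W[unfolded infinity_ennreal_def]])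
  then have "(\<lambda>k. ennreal ((a k)\<^sup>2)) \<longlonglongrightarrow> 0"
    by (intro tendsto_sandwich[OF _ _ tendsto_const, of 0 "\<lambda>k. ennreal ((a k)\<^sup>2)" sequentially "\<lambda>k. W * D k"])
      (use le in simp_all)
  then have "(\<lambda>k. (a k)\<^sup>2) \<longlonglongrightarrow> 0" by (subst (asm) ennreal_tendsto_0_iff) auto
  then have "a \<longlonglongrightarrow> 0" by simp
  then show ?thesis unfolding a_def by (simp add: tendsto_norm_zero_iff LIM_zero_iff)
qed

text \<open>\<open>window 0\<close> is the multiplier \<open>w\<close>. Moving the interval to end
  at \<open>\<xi>\<close> multiplies it by the Fourier kernel at \<open>\<xi>\<close>, so the
  transform of \<open>f * window 0\<close> at \<open>\<xi>\<close> is the integral of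
  \<open>f * window \<xi>\<close>, which corresponds to that of \<open>fhat\<close> over
  \<open>{\<xi> - 1..\<xi>}\<close>.\<close>

definition window :: "real \<Rightarrow> real \<Rightarrow> complex" where
  "window \<xi> = fourier_L1 (indicator {\<xi> - 1..\<xi>})"

lemma integrable_indicator_Icc_real: "integrable lebesgue (indicator {a..b::real} :: real \<Rightarrow> real)"
  by (rule integrable_real_indicator) (auto simp: emeasure_lborel_Icc_eq)

lemma integrable_indicator_Icc: "integrable lebesgue (indicator {a..b::real} :: real \<Rightarrow> complex)"
proof -
  have "integrable lebesgue (\<lambda>x. complex_of_real (indicator {a..b::real} x))"
    by (rule integrable_of_real[OF integrable_indicator_Icc_real])
  then show ?thesis by (simp add: of_real_indicator)
qed

lemma window_eq:
  assumes t: "t \<noteq> 0"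
  shows "window \<xi> t = exp (- 2 * of_real pi * \<i> * of_real t * of_real \<xi>)
           * ((exp (2 * of_real pi * \<i> * of_real t) - 1) / (2 * of_real pi * \<i> * of_real t))"
proof -
  define \<alpha> where "\<alpha> = 2 * of_real pi * \<i> * complex_of_real t"
  have \<alpha>: "\<alpha> \<noteq> 0" using t by (simp add: \<alpha>_def)
  have "window \<xi> t = (\<integral>x. indicator {\<xi> - 1..\<xi>} x *\<^sub>R exp (- \<alpha> * of_real x) \<partial>lebesgue)"
    unfolding window_def fourier_L1_def
    by (intro Bochner_Integration.integral_cong refl) (simp add: \<alpha>_def indicator_def mult_ac)
  also have "\<dots> = (\<integral>x. indicator {\<xi> - 1..\<xi>} x *\<^sub>R exp (- \<alpha> * of_real x) \<partial>lborel)"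
    by (rule integral_completion) measurable
  also have "\<dots> = exp (- \<alpha> * of_real \<xi>) / (- \<alpha>) - exp (- \<alpha> * of_real (\<xi> - 1)) / (- \<alpha>)"
  proof (rule integral_FTC_Icc)
    show "\<xi> - 1 \<le> \<xi>" by simp
    fix x :: real
    have "((\<lambda>z. exp (- \<alpha> * z) / (- \<alpha>)) has_field_derivative exp (- \<alpha> * of_real x)) (at (of_real x))"
      using \<alpha> by (auto intro!: derivative_eq_intros)
    then have "((\<lambda>x. exp (- \<alpha> * of_real x) / (- \<alpha>)) has_vector_derivative exp (- \<alpha> * of_real x)) (at x)"
      by (rule has_vector_derivative_real_field)
    then show "((\<lambda>x. exp (- \<alpha> * of_real x) / (- \<alpha>)) has_vector_derivative exp (- \<alpha> * of_real x)) (at x within {\<xi> - 1..\<xi>})"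
      by (rule has_vector_derivative_at_within)
    show "continuous_on {\<xi> - 1..\<xi>} (\<lambda>x. exp (- \<alpha> * of_real x))" by (intro continuous_intros)
  qed
  also have "exp (- \<alpha> * of_real (\<xi> - 1)) = exp (- \<alpha> * of_real \<xi>) * exp \<alpha>"
    by (simp add: algebra_simps flip: exp_add)
  finally have "window \<xi> t = exp (- \<alpha> * of_real \<xi>) * ((exp \<alpha> - 1) / \<alpha>)"
    using \<alpha> by (simp add: field_simps)
  then show ?thesis by (simp add: \<alpha>_def)
qed

lemma window_shift: "window \<xi> t = exp (- 2 * of_real pi * \<i> * of_real t * of_real \<xi>) * window 0 t"
proof (cases "t = 0")
  case True
  have 1: "window c 0 = 1" for c
  proof -
    have "window c 0 = (\<integral>x. complex_of_real (indicator {c - 1..c} x) \<partial>lebesgue)"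
      unfolding window_def fourier_L1_def by (simp add: of_real_indicator)
    also have "\<dots> = of_real (\<integral>x. indicator {c - 1..c} x \<partial>lebesgue)" by (rule integral_of_real[OF integrable_indicator_Icc_real])
    also have "(\<integral>x. indicator {c - 1..c} x \<partial>lebesgue) = (1::real)" by simp
    finally show ?thesis by simp
  qed
  show ?thesis by (simp add: 1 True)
next
  case False
  then show ?thesis by (simp add: window_eq[of t \<xi>] window_eq[of t 0])
qed

lemma norm_window_le_1: "norm (window \<xi> t) \<le> 1"
proof -
  have "norm (window \<xi> t) \<le> (\<integral>x. norm (indicator {\<xi> - 1..\<xi>} x * exp (- 2 * of_real pi * \<i> * of_real x * of_real t)) \<partial>lebesgue)"
    unfolding window_def fourier_L1_def by (rule integral_norm_bound)
  also have "\<dots> = (\<integral>x. indicator {\<xi> - 1..\<xi>} x \<partial>lebesgue)"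
    by (intro Bochner_Integration.integral_cong refl) (simp add: norm_mult indicator_def)
  also have "\<dots> = 1" by simp
  finally show ?thesis .
qed

lemma continuous_on_fourier_L1:
  assumes g: "integrable lebesgue g"
  shows "continuous_on A (fourier_L1 g)"
proof (rule continuous_on_sequentiallyI)
  fix u :: "nat \<Rightarrow> real" and t assume u: "u \<longlonglongrightarrow> t"
  show "(\<lambda>n. fourier_L1 g (u n)) \<longlonglongrightarrow> fourier_L1 g t"
    unfolding fourier_L1_def
  proof (rule integral_dominated_convergence[where w = "\<lambda>x. norm (g x)"])
    show "AE x in lebesgue. (\<lambda>i. g x * exp (- 2 * of_real pi * \<i> * of_real x * of_real (u i)))
        \<longlonglongrightarrow> g x * exp (- 2 * of_real pi * \<i> * of_real x * of_real t)"
      by (intro AE_I2 tendsto_intros u)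
    show "AE x in lebesgue. norm (g x * exp (- 2 * of_real pi * \<i> * of_real x * of_real (u i))) \<le> norm (g x)" for i
      by (simp add: norm_mult)
  qed (use g fourier_L1_integrable[OF g] in \<open>auto dest: borel_measurable_integrable\<close>)
qed

lemma borel_measurable_fourier_L1:
  assumes "integrable lebesgue g"
  shows "fourier_L1 g \<in> borel_measurable lebesgue"
  by (intro measurable_completion)
    (simp add: borel_measurable_continuous_onI continuous_on_fourier_L1[OF assms])

text \<open>Compare with \<open>2 / (1 + t^2)\<close>: the window is at most 1 for
  \<open>\<bar>t\<bar> \<le> 1\<close>, and at most \<open>1 / \<bar>t\<bar>\<close> elsewhere by
  the closed form.\<close>

lemma L2_fun_window: "L2_fun (window \<xi>)"
proof -
  have meas: "window \<xi> \<in> borel_measurable lebesgue"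
    unfolding window_def by (intro borel_measurable_fourier_L1 integrable_indicator_Icc)
  have "integrable lebesgue (\<lambda>t::real. 2 * inverse (1 + t\<^sup>2))"
  proof -
    have "integrable lborel (\<lambda>t::real. inverse (1 + t\<^sup>2))"
      using integrable_inverse_1_plus_square by (simp add: set_integrable_def)
    then have "integrable lborel (\<lambda>t::real. 2 * inverse (1 + t\<^sup>2))" by simp
    then show ?thesis by (subst integrable_completion) auto
  qed
  then have "integrable lebesgue (\<lambda>t. (norm (window \<xi> t))\<^sup>2)"
  proof (rule Bochner_Integration.integrable_bound)
    show "(\<lambda>t. (norm (window \<xi> t))\<^sup>2) \<in> borel_measurable lebesgue" using meas by measurable
    have "(norm (window \<xi> t))\<^sup>2 \<le> 2 * inverse (1 + t\<^sup>2)" for t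
    proof (cases "\<bar>t\<bar> \<le> 1")
      case True
      then have "t\<^sup>2 \<le> 1" by (simp add: abs_square_le_1)
      then have "1 \<le> 2 * inverse (1 + t\<^sup>2)" by (simp add: field_simps add_pos_nonneg)
      moreover have "(norm (window \<xi> t))\<^sup>2 \<le> 1" using norm_window_le_1 by (simp add: power_le_one)
      ultimately show ?thesis by linarith
    next
      case False
      then have t: "t \<noteq> 0" "1 \<le> t\<^sup>2" by (auto simp: abs_square_le_1 not_le intro: less_imp_le)
        (use False abs_square_le_1 in force)
      have "norm (exp (2 * of_real pi * \<i> * of_real t) - 1) \<le> 2"
        using norm_triangle_ineq4[of "exp (2 * of_real pi * \<i> * of_real t)" 1] by simp
      then have "norm (window \<xi> t) \<le> 2 / (2 * pi * \<bar>t\<bar>)"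
        unfolding window_eq[OF t(1)] norm_mult norm_divide
        using t by (simp add: norm_mult divide_simps)
      also have "\<dots> \<le> 1 / \<bar>t\<bar>" using t pi_ge_two by (simp add: field_simps)
      finally have "(norm (window \<xi> t))\<^sup>2 \<le> (1 / \<bar>t\<bar>)\<^sup>2" by (intro power_mono) auto
      also have "\<dots> \<le> 2 * inverse (1 + t\<^sup>2)" using t by (simp add: field_simps power_divide add_pos_nonneg)
      finally show ?thesis .
    qed
    moreover have "0 \<le> 2 * inverse (1 + t\<^sup>2)" for t :: real by (simp add: add_nonneg_nonneg)
    ultimately show "AE t in lebesgue. norm ((norm (window \<xi> t))\<^sup>2) \<le> norm (2 * inverse (1 + t\<^sup>2))"
      by auto
  qed
  with meas show ?thesis by (simp add: L2_fun_def)
qed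

text \<open>Zeros can occur only at integers. This allows passing back from
  \<open>f * window 0\<close> to \<open>f\<close>.\<close>

lemma AE_window_nonzero: "AE t in lebesgue. window 0 t \<noteq> 0"
proof -
  have "AE t in lborel. t \<notin> (range real_of_int)"
    by (intro AE_not_in countable_imp_null_set_lborel) simp
  then have "AE t in lebesgue. t \<notin> (range real_of_int)" by (rule AE_completion)
  then show ?thesis
  proof eventually_elim
    case (elim t)
    then have t: "t \<noteq> 0" by (metis of_int_0 rangeI)
    have "exp (2 * of_real pi * \<i> * of_real t) \<noteq> (1::complex)"
    proof
      assume "exp (2 * of_real pi * \<i> * of_real t) = (1::complex)"
      then obtain n :: int where "2 * pi * t = of_int (2 * n) * pi" by (auto simp: exp_eq_1)
      then have "t = of_int n" by simp
      then show False using elim by auto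
    qed
    then show ?case using t by (simp add: window_eq[OF t])
  qed
qed

text \<open>For the approximants \<open>h k\<close> the multiplication formula equates the integral
  of \<open>h k * window \<xi>\<close> with that of their transform over
  \<open>{\<xi> - 1..\<xi>}\<close>. Both sides converge by \<open>L2_tendsto_integral\<close>, and
  the limit on the right is 0.\<close>

lemma fourier_L1_windowed_zero:
  assumes F: "has_fourier_L2 f fhat"
    and zero: "AE \<eta> in lebesgue. \<eta> \<in> {\<xi> - 1..\<xi>} \<longrightarrow> fhat \<eta> = 0"
  shows "fourier_L1 (\<lambda>t. f t * window 0 t) \<xi> = 0"
proof -
  obtain h where h: "\<And>k. integrable lebesgue (h k)" "\<And>k. L2_fun (h k)"
    and hf: "L2_tendsto h f" and hF: "L2_tendsto (\<lambda>k. fourier_L1 (h k)) fhat"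
    and f: "L2_fun f" and fhat: "L2_fun fhat"
    using F by (auto simp: has_fourier_L2_def)
  let ?I = "indicator {\<xi> - 1..\<xi>} :: real \<Rightarrow> complex"
  have mult: "(\<integral>x. h k x * window \<xi> x \<partial>lebesgue) = (\<integral>x. fourier_L1 (h k) x * ?I x \<partial>lebesgue)" for k
    unfolding window_def by (rule fourier_L1_multiplication_formula[OF h(1) integrable_indicator_Icc])
  have I: "L2_fun ?I"
  proof -
    have "(\<lambda>x. (norm (?I x))\<^sup>2) = indicator {\<xi> - 1..\<xi>}" by (auto simp: indicator_def)
    then show ?thesis
      using integrable_indicator_Icc_real borel_measurable_integrable[OF integrable_indicator_Icc] by (simp add: L2_fun_def)
  qed
  have "integrable lebesgue (\<lambda>x. fourier_L1 (h k) x * ?I x)" for k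
  proof -
    have bnd: "norm (fourier_L1 (h k) x) \<le> (\<integral>t. norm (h k t) \<partial>lebesgue)" for x
    proof -
      have "norm (fourier_L1 (h k) x) \<le> (\<integral>t. norm (h k t * exp (- 2 * of_real pi * \<i> * of_real t * of_real x)) \<partial>lebesgue)"
        unfolding fourier_L1_def by (rule integral_norm_bound)
      then show ?thesis by (simp add: norm_mult)
    qed
    have "integrable lebesgue (\<lambda>x. of_real (\<integral>t. norm (h k t) \<partial>lebesgue) * ?I x)"
      by (intro integrable_mult_right integrable_indicator_Icc)
    then show ?thesis
    proof (rule Bochner_Integration.integrable_bound)
      show "(\<lambda>x. fourier_L1 (h k) x * ?I x) \<in> borel_measurable lebesgue"
        using borel_measurable_fourier_L1[OF h(1)] borel_measurable_integrable[OF integrable_indicator_Icc]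
        by (intro borel_measurable_times) auto
      show "AE x in lebesgue. norm (fourier_L1 (h k) x * ?I x) \<le> norm (of_real (\<integral>t. norm (h k t) \<partial>lebesgue) * ?I x)"
        using bnd by (intro AE_I2) (simp add: norm_mult mult_right_mono abs_of_nonneg order_trans[OF norm_ge_zero bnd])
    qed
  qed
  then have "(\<lambda>k. \<integral>x. fourier_L1 (h k) x * ?I x \<partial>lebesgue) \<longlonglongrightarrow> (\<integral>x. fhat x * ?I x \<partial>lebesgue)"
    by (intro L2_tendsto_integral borel_measurable_fourier_L1 h fhat I hF)
  moreover have "(\<lambda>k. \<integral>x. h k x * window \<xi> x \<partial>lebesgue) \<longlonglongrightarrow> (\<integral>x. f x * window \<xi> x \<partial>lebesgue)"
    using h(1) by (intro L2_tendsto_integral L2_fun_mult_integrable h f L2_fun_window hf) auto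
  ultimately have "(\<integral>x. f x * window \<xi> x \<partial>lebesgue) = (\<integral>x. fhat x * ?I x \<partial>lebesgue)"
    unfolding mult by (rule LIMSEQ_unique[rotated])
  also have "\<dots> = (\<integral>x. 0 \<partial>(lebesgue :: real measure))"
  proof (rule integral_cong_AE)
    show "(\<lambda>x. fhat x * ?I x) \<in> borel_measurable lebesgue"
      using L2_fun_mult_integrable[OF fhat I] by auto
    show "AE x in lebesgue. fhat x * ?I x = 0"
      using zero by eventually_elim (auto simp: indicator_def)
  qed simp
  finally have "(\<integral>x. f x * window \<xi> x \<partial>lebesgue) = 0" by simp
  moreover have "f t * window 0 t * exp (- 2 * of_real pi * \<i> * of_real t * of_real \<xi>) = f t * window \<xi> t" for t
    using window_shift[of \<xi> t] by simp
  ultimately show ?thesis by (simp only: fourier_L1_def)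
qed

subsection \<open>Laplace integrals\<close>

text \<open>Common setting for the two half-lines: \<open>s\<close> is \<open>2 * pi\<close> times
  the signed distance from \<open>c\<close>, and \<open>a\<close> comes from the gap around
  \<open>c\<close>. As \<open>s\<close> matters only where \<open>g\<close> is nonzero, it may be
  negative elsewhere.\<close>

locale laplace_integral =
  fixes M :: "'a measure" and g :: "'a \<Rightarrow> complex" and s :: "'a \<Rightarrow> real" and a :: real
  assumes int_g: "integrable M g"
    and meas_s: "s \<in> borel_measurable M"
    and a_pos: "a > 0"
    and supp: "AE x in M. g x \<noteq> 0 \<longrightarrow> a \<le> s x"
begin

definition L :: "complex \<Rightarrow> complex" where
  "L z = (\<integral>x. g x * exp (- of_real (s x) * z) \<partial>M)"

lemma meas_integrand: "(\<lambda>x. g x * exp (- of_real (s x) * z)) \<in> borel_measurable M"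
proof -
  have [measurable]: "g \<in> borel_measurable M" "s \<in> borel_measurable M"
    using int_g meas_s by auto
  show ?thesis by measurable
qed

lemma norm_integrand_le:
  assumes "Re z \<ge> 0"
  shows "AE x in M. norm (g x * exp (- of_real (s x) * z)) \<le> norm (g x) * exp (- a * Re z)"
  using supp
proof eventually_elim
  case (elim x)
  show ?case
  proof (cases "g x = 0")
    case False
    then have "a * Re z \<le> s x * Re z" using elim assms by (intro mult_right_mono) auto
    then show ?thesis by (auto simp: norm_mult intro!: mult_left_mono)
  qed simp
qed

lemma integrable_integrand:
  assumes "Re z \<ge> 0"
  shows "integrable M (\<lambda>x. g x * exp (- of_real (s x) * z))"
proof (rule Bochner_Integration.integrable_bound[OF int_g meas_integrand])
  show "AE x in M. norm (g x * exp (- of_real (s x) * z)) \<le> norm (g x)"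
    using norm_integrand_le[OF assms]
  proof eventually_elim
    case (elim x)
    have "norm (g x) * exp (- a * Re z) \<le> norm (g x) * 1"
      using a_pos assms by (intro mult_left_mono) auto
    then show ?case using elim by linarith
  qed
qed

lemma norm_L_le:
  assumes "Re z \<ge> 0"
  shows "norm (L z) \<le> (\<integral>x. norm (g x) \<partial>M) * exp (- a * Re z)"
proof -
  have "norm (L z) \<le> (\<integral>x. norm (g x * exp (- of_real (s x) * z)) \<partial>M)"
    unfolding L_def by (rule integral_norm_bound)
  also have "\<dots> \<le> (\<integral>x. norm (g x) * exp (- a * Re z) \<partial>M)"
    using norm_integrand_le[OF assms] integrable_integrand[OF assms] int_g
    by (intro integral_mono_AE) auto
  finally show ?thesis by simp
qed

lemma continuous_on_L: "continuous_on {z. Re z \<ge> 0} L"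
proof (rule continuous_on_sequentiallyI)
  fix u :: "nat \<Rightarrow> complex" and z
  assume u: "\<forall>n. u n \<in> {z. Re z \<ge> 0}" "z \<in> {z. Re z \<ge> 0}" "u \<longlonglongrightarrow> z"
  show "(\<lambda>n. L (u n)) \<longlonglongrightarrow> L z"
    unfolding L_def
  proof (rule integral_dominated_convergence[where w = "\<lambda>x. norm (g x)"])
    show "AE x in M. (\<lambda>i. g x * exp (- of_real (s x) * u i)) \<longlonglongrightarrow> g x * exp (- of_real (s x) * z)"
      by (intro AE_I2 tendsto_intros u)
    show "AE x in M. norm (g x * exp (- of_real (s x) * u i)) \<le> norm (g x)" for i
    proof -
      have ui: "Re (u i) \<ge> 0" using u by simp
      show ?thesis using norm_integrand_le[OF ui]
      proof eventually_elim
        case (elim x)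
        have "norm (g x) * exp (- a * Re (u i)) \<le> norm (g x) * 1"
          using a_pos ui by (intro mult_left_mono) auto
        then show ?case using elim by linarith
      qed
    qed
  qed (use meas_integrand int_g in auto)
qed

text \<open>A majorant uniform in \<open>t\<close>, for differentiation under the integral:
  \<open>exp\<close> has derivative at most \<open>exp (- t * r)\<close> on a convex half-plane, and
  \<open>t * exp (- t * r) \<le> 1 / r\<close>.\<close>

lemma norm_exp_diff_quotient_le:
  fixes t r :: real and z w :: complex
  assumes "t \<ge> 0" "r > 0" "Re z \<ge> r" "Re w \<ge> r" "z \<noteq> w"
  shows "norm ((exp (- of_real t * z) - exp (- of_real t * w)) / (z - w)) \<le> 1 / r"
proof -
  have "norm (exp (- of_real t * z) - exp (- of_real t * w))
      \<le> exp (- t * r) * norm (- of_real t * z - - of_real t * w)"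
  proof (rule field_differentiable_bound[where S = "{p. Re p \<le> - t * r}" and f' = exp])
    show "convex {p. Re p \<le> - t * r}" by (rule convex_halfspace_Re_le)
    show "- of_real t * z \<in> {p. Re p \<le> - t * r}" "- of_real t * w \<in> {p. Re p \<le> - t * r}"
      using assms by (auto intro!: mult_left_mono)
  qed (auto intro!: derivative_eq_intros)
  also have "- of_real t * z - - of_real t * w = of_real (- t) * (z - w)"
    by (simp add: algebra_simps)
  also have "norm \<dots> = t * norm (z - w)" using assms by (simp add: norm_mult)
  finally have "norm ((exp (- of_real t * z) - exp (- of_real t * w)) / (z - w)) \<le> exp (- t * r) * t"
    using assms by (simp add: norm_divide divide_le_eq mult.assoc)
  also have "\<dots> \<le> 1 / r"
  proof -
    have "t * r \<le> exp (t * r)" using exp_ge_add_one_self[of "t * r"] by linarith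
    then show ?thesis using assms by (simp add: exp_minus field_simps)
  qed
  finally show ?thesis .
qed

lemma holomorphic_on_L: "L holomorphic_on {z. Re z > 0}"
proof -
  have "\<exists>D. (L has_field_derivative D) (at z)" if z: "Re z > 0" for z
  proof -
    \<comment> \<open>On the half-plane \<open>S\<close> around \<open>z\<close> the difference
      quotients are dominated by \<open>norm (g x) / r\<close>.\<close>
    define r where "r = Re z / 2"
    define S where "S = {w. Re w > r}"
    have r: "r > 0" "r < Re z" using z by (auto simp: r_def)
    have S: "open S" "z \<in> S" using r by (auto simp: S_def open_halfspace_Re_gt)
    define q where "q = (\<lambda>x w. g x * ((exp (- of_real (s x) * w) - exp (- of_real (s x) * z)) / (w - z)))"
    define D where "D = (\<integral>x. g x * (- of_real (s x) * exp (- of_real (s x) * z)) \<partial>M)"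
    have [measurable]: "g \<in> borel_measurable M" "s \<in> borel_measurable M"
      using int_g meas_s by auto
    have "((\<lambda>w. (L w - L z) / (w - z)) \<longlongrightarrow> D) (at z within S)"
      unfolding tendsto_at_iff_sequentially comp_def
    proof (intro allI impI)
      fix u assume u: "\<forall>i. u i \<in> S - {z}" "u \<longlonglongrightarrow> z"
      have "(\<lambda>i. \<integral>x. q x (u i) \<partial>M) \<longlonglongrightarrow> D"
        unfolding D_def
      proof (rule integral_dominated_convergence[where w = "\<lambda>x. norm (g x) * (1 / r)"])
        show "integrable M (\<lambda>x. norm (g x) * (1 / r))" using int_g by (intro integrable_mult_left) auto
        show "AE x in M. norm (q x (u i)) \<le> norm (g x) * (1 / r)" for i
          using supp
        proof eventually_elim
          case (elim x)
          show ?case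
          proof (cases "g x = 0")
            case False
            then have "s x \<ge> 0" using elim a_pos by auto
            then show ?thesis unfolding q_def norm_mult[of "g x"]
              using u r by (intro mult_left_mono norm_exp_diff_quotient_le) (auto simp: S_def less_imp_le)
          qed (simp add: q_def)
        qed
        show "AE x in M. (\<lambda>i. q x (u i)) \<longlonglongrightarrow> g x * (- of_real (s x) * exp (- of_real (s x) * z))"
        proof (intro AE_I2)
          fix x
          have "((\<lambda>w. exp (- of_real (s x) * w)) has_field_derivative - of_real (s x) * exp (- of_real (s x) * z)) (at z)"
            by (auto intro!: derivative_eq_intros)
          then have "((\<lambda>w. (exp (- of_real (s x) * w) - exp (- of_real (s x) * z)) / (w - z))
              \<longlongrightarrow> - of_real (s x) * exp (- of_real (s x) * z)) (at z)"
            by (simp add: has_field_derivative_iff)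
          then have "(\<lambda>i. (exp (- of_real (s x) * u i) - exp (- of_real (s x) * z)) / (u i - z))
              \<longlonglongrightarrow> - of_real (s x) * exp (- of_real (s x) * z)"
            using u unfolding tendsto_at_iff_sequentially comp_def by auto
          then show "(\<lambda>i. q x (u i)) \<longlonglongrightarrow> g x * (- of_real (s x) * exp (- of_real (s x) * z))"
            unfolding q_def by (rule tendsto_mult_left)
        qed
        show "(\<lambda>x. q x (u i)) \<in> borel_measurable M" for i unfolding q_def by measurable
        show "(\<lambda>x. g x * (- of_real (s x) * exp (- of_real (s x) * z))) \<in> borel_measurable M" by measurable
      qed
      moreover have "(\<integral>x. q x (u i) \<partial>M) = (L (u i) - L z) / (u i - z)" for i
      proof -
        have ui: "Re (u i) \<ge> 0" using u r by (auto simp: S_def intro: less_imp_le less_trans)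
        have "(\<integral>x. q x (u i) \<partial>M) =
            (\<integral>x. (g x * exp (- of_real (s x) * u i) - g x * exp (- of_real (s x) * z)) / (u i - z) \<partial>M)"
          by (simp add: q_def right_diff_distrib)
        also have "\<dots> = (L (u i) - L z) / (u i - z)"
          unfolding L_def integral_divide_zero
          using integrable_integrand[OF ui] integrable_integrand[of z] z
          by (subst Bochner_Integration.integral_diff) auto
        finally show ?thesis .
      qed
      ultimately show "(\<lambda>i. (L (u i) - L z) / (u i - z)) \<longlonglongrightarrow> D" by simp
    qed
    then have "(L has_field_derivative D) (at z within S)" by (simp add: has_field_derivative_iff)
    then show ?thesis using S at_within_open by metis
  qed
  then show ?thesis
    unfolding holomorphic_on_def field_differentiable_def
    using has_field_derivative_at_within by blast
qed

text \<open>The identity theorem covers the open half-plane, and continuity its boundary, which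
  carries the Fourier transform.\<close>

lemma L_zero_if_zero_on_reals:
  assumes zero: "\<And>y. y > 0 \<Longrightarrow> L (of_real y) = 0" and z: "Re z \<ge> 0"
  shows "L z = 0"
proof -
  have interior: "L w = 0" if "Re w > 0" for w
  proof (rule analytic_continuation[OF holomorphic_on_L, where U = "of_real ` {0<..}" and \<xi> = 1])
    show "open {z. Re z > 0}" by (rule open_halfspace_Re_gt)
    show "connected {z. Re z > 0}" by (intro convex_connected convex_halfspace_Re_gt)
    show "(1::complex) islimpt of_real ` {0<..}"
      unfolding islimpt_sequential
    proof (intro exI conjI allI)
      fix n
      show "1 + of_real (1 / real (Suc n)) \<in> of_real ` {0<..} - {1::complex}"
      proof -
        have "1 + complex_of_real (1 / real (Suc n)) = of_real (1 + 1 / real (Suc n))" by simp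
        moreover have "1 + 1 / real (Suc n) \<in> {0<..}" by (simp add: add_pos_pos)
        moreover have "1 / real (Suc n) \<noteq> 0" by simp
        ultimately show ?thesis by (metis DiffI add_cancel_right_right image_eqI of_real_eq_0_iff singletonD)
      qed
    next
      have "(\<lambda>n. 1 + complex_of_real (1 / real (Suc n))) \<longlonglongrightarrow> 1 + of_real 0"
        by (intro tendsto_intros LIMSEQ_inverse_real_of_nat[unfolded inverse_eq_divide])
      then show "(\<lambda>n. 1 + complex_of_real (1 / real (Suc n))) \<longlonglongrightarrow> 1" by simp
    qed
  qed (use that zero in auto)
  have lim: "(\<lambda>n. z + of_real (1 / real (Suc n))) \<longlonglongrightarrow> z"
  proof -
    have "(\<lambda>n. z + of_real (1 / real (Suc n))) \<longlonglongrightarrow> z + of_real 0"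
      by (intro tendsto_intros LIMSEQ_inverse_real_of_nat[unfolded inverse_eq_divide])
    then show ?thesis by simp
  qed
  have pos: "Re (z + of_real (1 / real (Suc n))) > 0" for n
    using z by (simp add: add_nonneg_pos)
  have "(\<lambda>n. L (z + of_real (1 / real (Suc n)))) \<longlonglongrightarrow> L z"
    by (rule continuous_on_tendsto_compose[OF continuous_on_L lim])
      (use z pos in \<open>auto intro!: always_eventually less_imp_le simp del: of_real_divide\<close>)
  moreover have "(\<lambda>n. L (z + of_real (1 / real (Suc n)))) = (\<lambda>n. 0)"
    using interior[OF pos] by (intro ext)
  ultimately show ?thesis by (simp add: LIMSEQ_const_iff)
qed

end

subsection \<open>Functions with sparse spectrum\<close>

text \<open>The union is locally finite: a convergent sequence is bounded and so meets only finitely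
  many of the closed pieces.\<close>

lemma closed_sparse_spectrum:
  fixes l :: "nat \<Rightarrow> real"
  assumes l: "filterlim l at_top sequentially"
  shows "closed {x. \<exists>n\<ge>1. l n - 1 \<le> \<bar>x\<bar> \<and> \<bar>x\<bar> \<le> l n + 2}"
proof -
  define E where "E = (\<lambda>n. {x. l n - 1 \<le> \<bar>x\<bar> \<and> \<bar>x\<bar> \<le> l n + 2})"
  have cE: "closed (E n)" for n
    unfolding E_def by (intro closed_Collect_conj closed_Collect_le continuous_intros)
  have "closed (\<Union>n\<in>{1..}. E n)"
    unfolding closed_sequential_limits
  proof (intro allI impI, elim conjE)
    fix u x assume u: "\<forall>n. u n \<in> (\<Union>n\<in>{1..}. E n)" "u \<longlonglongrightarrow> x"
    obtain B where B: "\<And>n. \<bar>u n\<bar> \<le> B"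
      using Bseq_def convergent_imp_Bseq[of u] u(2) by (auto simp: convergent_def Bseq_def)
    obtain N where N: "\<And>n. n \<ge> N \<Longrightarrow> B + 2 \<le> l n"
      using l unfolding filterlim_at_top eventually_sequentially by blast
    have "u n \<in> (\<Union>m\<in>{1..<N}. E m)" for n
    proof -
      obtain m where m: "m \<ge> 1" "u n \<in> E m" using u(1) by blast
      have "m < N"
      proof (rule ccontr)
        assume "\<not> m < N"
        then show False using N[of m] m B[of n] by (auto simp: E_def)
      qed
      then show ?thesis using m by auto
    qed
    moreover have "closed (\<Union>m\<in>{1..<N}. E m)" using cE by (intro closed_UN) auto
    ultimately have "x \<in> (\<Union>m\<in>{1..<N}. E m)" using u(2) closed_sequentially by metis
    then show "x \<in> (\<Union>n\<in>{1..}. E n)" by auto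
  qed
  moreover have "(\<Union>n\<in>{1..}. E n) = {x. \<exists>n\<ge>1. l n - 1 \<le> \<bar>x\<bar> \<and> \<bar>x\<bar> \<le> l n + 2}"
    by (auto simp: E_def)
  ultimately show ?thesis by simp
qed

lemma fourier_L1_zero_if_sparse_spectrum:
  fixes l :: "nat \<Rightarrow> real" and g :: "real \<Rightarrow> complex"
  assumes l1: "\<And>n. n \<ge> 1 \<Longrightarrow> l n > 1"
    and sep: "\<And>n. n \<ge> 1 \<Longrightarrow> l n * (1 + 1 / ln (l n)) < l (n + 1) * (1 - 1 / ln (l (n + 1)))"
    and sm: "(\<lambda>n. 1 / (ln (l n))\<^sup>2) summable_on {1..}"
    and g: "integrable lebesgue g"
    and a: "a > 0" and gap: "AE t in lebesgue. t \<in> ball c a \<longrightarrow> g t = 0"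
    and spec: "\<And>\<xi>. fourier_L1 g \<xi> \<noteq> 0 \<Longrightarrow> \<exists>n\<ge>1. l n - 1 \<le> \<bar>\<xi>\<bar> \<and> \<bar>\<xi>\<bar> \<le> l n + 2"
  shows "fourier_L1 g \<xi> = 0"
proof -
  define gp where "gp = (\<lambda>t. indicator {c..} t *\<^sub>R g t)"
  define gm where "gm = (\<lambda>t. indicator {..<c} t *\<^sub>R g t)"
  define b where "b = 2 * pi * a"
  have b: "b > 0" using a by (simp add: b_def)
  have int_p: "integrable lebesgue gp" and int_m: "integrable lebesgue gm"
    unfolding gp_def gm_def by (intro integrable_mult_indicator g; simp)+
  interpret P: laplace_integral lebesgue gp "\<lambda>t. 2 * pi * (t - c)" b
  proof
    show "(\<lambda>t. 2 * pi * (t - c)) \<in> borel_measurable lebesgue" by (rule measurable_completion) simp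
    show "AE t in lebesgue. gp t \<noteq> 0 \<longrightarrow> b \<le> 2 * pi * (t - c)"
      using gap by eventually_elim (auto simp: gp_def b_def indicator_def dist_real_def split: if_splits)
  qed (use int_p b in auto)
  interpret M: laplace_integral lebesgue gm "\<lambda>t. 2 * pi * (c - t)" b
  proof
    show "(\<lambda>t. 2 * pi * (c - t)) \<in> borel_measurable lebesgue" by (rule measurable_completion) simp
    show "AE t in lebesgue. gm t \<noteq> 0 \<longrightarrow> b \<le> 2 * pi * (c - t)"
      using gap by eventually_elim (auto simp: gm_def b_def indicator_def dist_real_def split: if_splits)
  qed (use int_m b in auto)
  \<comment> \<open>The two boundary values on the real line add up to the transform of
    \<open>g\<close>; the unimodular factor comes from measuring \<open>t\<close> from
    \<open>c\<close>.\<close>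
  have jump: "P.L (\<i> * of_real x) + M.L (- \<i> * of_real x) = exp (2 * of_real pi * \<i> * of_real c * of_real x) * fourier_L1 g x" for x
  proof -
    let ?e = "exp (2 * of_real pi * \<i> * of_real c * of_real x)"
    have ip: "integrable lebesgue (\<lambda>t. gp t * exp (- of_real (2 * pi * (t - c)) * (\<i> * of_real x)))"
      by (rule P.integrable_integrand) simp
    have im: "integrable lebesgue (\<lambda>t. gm t * exp (- of_real (2 * pi * (c - t)) * (- \<i> * of_real x)))"
      by (rule M.integrable_integrand) simp
    have "P.L (\<i> * of_real x) + M.L (- \<i> * of_real x)
        = (\<integral>t. gp t * exp (- of_real (2 * pi * (t - c)) * (\<i> * of_real x))
            + gm t * exp (- of_real (2 * pi * (c - t)) * (- \<i> * of_real x)) \<partial>lebesgue)"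
      unfolding P.L_def M.L_def by (rule Bochner_Integration.integral_add[symmetric, OF ip im])
    also have "\<dots> = (\<integral>t. ?e * (g t * exp (- 2 * of_real pi * \<i> * of_real t * of_real x)) \<partial>lebesgue)"
    proof (rule Bochner_Integration.integral_cong[OF refl])
      fix t
      have 1: "exp (- of_real (2 * pi * (t - c)) * (\<i> * of_real x)) = ?e * exp (- 2 * of_real pi * \<i> * of_real t * of_real x)"
        by (simp add: algebra_simps flip: exp_add)
      have 2: "exp (- of_real (2 * pi * (c - t)) * (- \<i> * of_real x)) = ?e * exp (- 2 * of_real pi * \<i> * of_real t * of_real x)"
        by (simp add: algebra_simps flip: exp_add)
      show "gp t * exp (- of_real (2 * pi * (t - c)) * (\<i> * of_real x))
            + gm t * exp (- of_real (2 * pi * (c - t)) * (- \<i> * of_real x))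
          = ?e * (g t * exp (- 2 * of_real pi * \<i> * of_real t * of_real x))"
        unfolding 1 2 by (cases "t < c") (auto simp: gp_def gm_def indicator_def)
    qed
    also have "\<dots> = ?e * fourier_L1 g x" by (simp only: fourier_L1_def integral_mult_right_zero)
    finally show ?thesis .
  qed

  define E where "E = {x. \<exists>n\<ge>1. l n - 1 \<le> \<bar>x\<bar> \<and> \<bar>x\<bar> \<le> l n + 2}"
  define K where "K = complex_of_real ` E"
  obtain n0 and H :: "nat \<Rightarrow> complex \<Rightarrow> complex" where n0: "n0 \<ge> 1"
    and lim: "filterlim (\<lambda>n. l (n + n0)) at_top sequentially"
    and H: "\<And>n. H n holomorphic_on UNIV"
    and Hs: "\<And>n z. norm z = l (n + n0) \<Longrightarrow> norm (H n z) \<le> exp (l (n + n0) powr (1/4))"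
    and HE: "\<And>n m x. 1 \<le> m \<Longrightarrow> l m - 1 \<le> \<bar>x\<bar> \<Longrightarrow> \<bar>x\<bar> \<le> l m + 2 \<Longrightarrow> \<bar>x\<bar> \<le> l (n + n0)
           \<Longrightarrow> norm (H n (of_real x)) \<le> 1"
    and Hi: "\<And>n y. norm (H n (\<i> * of_real y)) \<ge> 1 + y\<^sup>2 / (l n0)\<^sup>2"
    using sparse_multiplier[OF l1 sep sm] by blast
  have closedE: "closed E"
    unfolding E_def using lim by (intro closed_sparse_spectrum)
      (simp add: filterlim_at_top eventually_sequentially_seg[of "\<lambda>n. _ \<le> l n" n0])
  have closedK: "closed K"
  proof -
    have "K = {z. Im z = 0} \<inter> Re -` E"
      by (auto simp: K_def complex_eq_iff image_iff)
    moreover have "closed (Re -` E)" by (intro continuous_closed_vimage closedE continuous_intros)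
    moreover have "closed {z. Im z = 0}" by (intro closed_Collect_eq continuous_intros)
    ultimately show ?thesis by auto
  qed

  \<comment> \<open>Multiplication by \<open>\<i>\<close> or \<open>- \<i>\<close> takes the lower
    or upper half-plane to the right one. The minus sign turns the sum in \<open>jump\<close> into
    the jump of \<open>G\<close> across the real line, which vanishes off \<open>E\<close>.\<close>
  define G where "G = (\<lambda>z. if Im z \<le> 0 then P.L (\<i> * z) else - M.L (- \<i> * z))"
  have cont: "continuous_on (- K) G"
    unfolding G_def
  proof (rule continuous_on_cases_le)
    show "continuous_on {z \<in> - K. Im z \<le> 0} (\<lambda>z. P.L (\<i> * z))"
      by (rule continuous_on_compose2[OF P.continuous_on_L]) (auto intro!: continuous_intros)
    show "continuous_on {z \<in> - K. 0 \<le> Im z} (\<lambda>z. - M.L (- \<i> * z))"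
      by (rule continuous_on_minus, rule continuous_on_compose2[OF M.continuous_on_L]) (auto intro!: continuous_intros)
    show "continuous_on (- K) Im" by (intro continuous_intros)
    fix z assume z: "z \<in> - K" "Im z = 0"
    then have zr: "z = of_real (Re z)" by (simp add: complex_eq_iff)
    then have "Re z \<notin> E" using z by (auto simp: K_def)
    then have "fourier_L1 g (Re z) = 0" using spec[of "Re z"] by (auto simp: E_def)
    then have "P.L (\<i> * z) + M.L (- \<i> * z) = 0" using jump[of "Re z"] zr by simp
    then show "P.L (\<i> * z) = - M.L (- \<i> * z)" by (simp add: eq_neg_iff_add_eq_0)
  qed
  have hol: "G holomorphic_on - K"
  \<comment> \<open>A function continuous on an open set and holomorphic on both sides of a line is
    holomorphic across it; \<open>\<i> \<bullet> z\<close> is \<open>Im z\<close>.\<close>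
  proof (rule holomorphic_on_paste_across_line[where d = \<i> and k = 0])
    have "(\<lambda>z. P.L (\<i> * z)) holomorphic_on {z. Im z < 0}"
      by (rule holomorphic_on_compose_gen[OF _ P.holomorphic_on_L, unfolded comp_def]) (auto intro!: holomorphic_intros)
    then have "(\<lambda>z. P.L (\<i> * z)) holomorphic_on (- K \<inter> {z. \<i> \<bullet> z < 0})"
      by (rule holomorphic_on_subset) auto
    then show "G holomorphic_on (- K \<inter> {z. \<i> \<bullet> z < 0})"
      by (rule holomorphic_transform) (auto simp: G_def)
    have "(\<lambda>z. M.L (- \<i> * z)) holomorphic_on {z. Im z > 0}"
      by (rule holomorphic_on_compose_gen[OF _ M.holomorphic_on_L, unfolded comp_def]) (auto intro!: holomorphic_intros)
    then have "(\<lambda>z. - M.L (- \<i> * z)) holomorphic_on (- K \<inter> {z. 0 < \<i> \<bullet> z})"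
      by (intro holomorphic_on_minus, rule holomorphic_on_subset) auto
    then show "G holomorphic_on (- K \<inter> {z. 0 < \<i> \<bullet> z})"
      by (rule holomorphic_transform) (auto simp: G_def)
  qed (use closedK cont in auto)
  define C where "C = (\<integral>t. norm (gp t) \<partial>lebesgue) + (\<integral>t. norm (gm t) \<partial>lebesgue)"
  have Gb: "norm (G z) \<le> C * exp (- b * \<bar>Im z\<bar>)" for z
  proof (cases "Im z \<le> 0")
    case True
    then have "norm (G z) \<le> (\<integral>t. norm (gp t) \<partial>lebesgue) * exp (- b * \<bar>Im z\<bar>)"
      using P.norm_L_le[of "\<i> * z"] by (simp add: G_def)
    also have "\<dots> \<le> C * exp (- b * \<bar>Im z\<bar>)" by (intro mult_right_mono) (auto simp: C_def)
    finally show ?thesis .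
  next
    case False
    then have "norm (G z) \<le> (\<integral>t. norm (gm t) \<partial>lebesgue) * exp (- b * \<bar>Im z\<bar>)"
      using M.norm_L_le[of "- \<i> * z"] by (simp add: G_def)
    also have "\<dots> \<le> C * exp (- b * \<bar>Im z\<bar>)" by (intro mult_right_mono) (auto simp: C_def)
    finally show ?thesis .
  qed
  have zero: "G (\<i> * of_real y) = 0" if y: "y \<noteq> 0" for y
  proof (rule vanishes_off_slits[OF closedK hol Gb b lim H Hs _ _ Hi])
    fix n z assume "z \<in> K" "norm z \<le> l (n + n0)"
    then show "norm (H n z) \<le> 1" using HE by (auto simp: K_def E_def)
  next
    show "1 < 1 + y\<^sup>2 / (l n0)\<^sup>2" using y l1[OF n0] by simp
    show "\<i> * of_real y \<notin> K" using y by (auto simp: K_def complex_eq_iff)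
  qed
  \<comment> \<open>For \<open>y > 0\<close>, \<open>P.L y\<close> and \<open>- M.L y\<close> are
    the values of \<open>G\<close> at \<open>- \<i> * y\<close> and \<open>\<i> * y\<close>, which
    vanish by \<open>zero\<close>.\<close>
  have "P.L (\<i> * of_real \<xi>) = 0"
  proof (rule P.L_zero_if_zero_on_reals)
    fix y :: real assume "y > 0"
    then show "P.L (of_real y) = 0" using zero[of "- y"] by (simp add: G_def)
  qed simp
  moreover have "M.L (- \<i> * of_real \<xi>) = 0"
  proof (rule M.L_zero_if_zero_on_reals)
    fix y :: real assume "y > 0"
    then show "M.L (of_real y) = 0" using zero[of y] by (simp add: G_def)
  qed simp
  ultimately show ?thesis using jump[of \<xi>] by simp
qed

section \<open>From integrable to square integrable functions by a window\<close>

theorem theorem3p1: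
  fixes l :: "nat \<Rightarrow> real" and f fhat :: "real \<Rightarrow> complex" and \<Sigma> U :: "real set"
  assumes "\<And>n. n \<ge> 1 \<Longrightarrow> l n > 1"
    and "\<And>n. n \<ge> 1 \<Longrightarrow> l n * (1 + 1 / ln (l n)) < l (n + 1) * (1 - 1 / ln (l (n + 1)))"
    and "(\<lambda>n. 1 / (ln (l n))\<^sup>2) summable_on {1..}"
    and "\<Sigma> = (\<Union>n\<in>{1..}. {- l n - 1 .. - l n} \<union> {l n .. l n + 1})"
    and "L2_fun f"
    and "has_fourier_L2 f fhat"
    and "AE \<xi> in lebesgue. \<xi> \<notin> \<Sigma> \<longrightarrow> fhat \<xi> = 0"
    and "open U" and "U \<noteq> {}"
    and "AE x in lebesgue. x \<in> U \<longrightarrow> f x = 0"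
  shows "AE x in lebesgue. f x = 0"
proof -
  define g where "g = (\<lambda>t. f t * window 0 t)"
  obtain c a where a: "a > 0" "ball c a \<subseteq> U"
    using \<open>open U\<close> \<open>U \<noteq> {}\<close> by (metis ex_in_conv open_contains_ball)
  have g: "integrable lebesgue g"
    unfolding g_def by (rule L2_fun_mult_integrable[OF \<open>L2_fun f\<close> L2_fun_window])
  have "fourier_L1 g \<xi> = 0" for \<xi>
  proof (rule fourier_L1_zero_if_sparse_spectrum[OF assms(1,2,3) g a(1)])
    show "AE t in lebesgue. t \<in> ball c a \<longrightarrow> g t = 0"
      using assms(10) by eventually_elim (use a in \<open>auto simp: g_def\<close>)
    fix \<xi> assume nz: "fourier_L1 g \<xi> \<noteq> 0"
    show "\<exists>n\<ge>1. l n - 1 \<le> \<bar>\<xi>\<bar> \<and> \<bar>\<xi>\<bar> \<le> l n + 2"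
    proof (rule ccontr)
      assume not: "\<not> (\<exists>n\<ge>1. l n - 1 \<le> \<bar>\<xi>\<bar> \<and> \<bar>\<xi>\<bar> \<le> l n + 2)"
      \<comment> \<open>The window reaches back by 1 from \<open>\<xi>\<close>: a point of
        \<open>[l n, l n + 1]\<close> in it puts \<open>\<xi>\<close> in
        \<open>[l n, l n + 2]\<close>, and one of the reflected interval puts \<open>- \<xi>\<close>
        in \<open>[l n - 1, l n + 1]\<close>, where \<open>l n > 1\<close> fixes the sign.\<close>
      have "\<eta> \<notin> \<Sigma>" if \<eta>: "\<eta> \<in> {\<xi> - 1..\<xi>}" for \<eta>
      proof
        assume "\<eta> \<in> \<Sigma>"
        then obtain n where n: "n \<ge> 1" "\<eta> \<in> {- l n - 1 .. - l n} \<or> \<eta> \<in> {l n .. l n + 1}"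
          by (auto simp: assms(4))
        then have "l n - 1 \<le> \<bar>\<xi>\<bar> \<and> \<bar>\<xi>\<bar> \<le> l n + 2" using \<eta> assms(1)[of n] by auto
        then show False using not n by blast
      qed
      then have "AE \<eta> in lebesgue. \<eta> \<in> {\<xi> - 1..\<xi>} \<longrightarrow> fhat \<eta> = 0"
        using assms(7) by (auto elim!: eventually_mono)
      then have "fourier_L1 g \<xi> = 0"
        unfolding g_def by (rule fourier_L1_windowed_zero[OF \<open>has_fourier_L2 f fhat\<close>])
      with nz show False by simp
    qed
  qed
  then have "AE t in lebesgue. g t = 0" by (rule fourier_L1_zero_imp_AE_zero[OF g])
  then show ?thesis
    using AE_window_nonzero by eventually_elim (auto simp: g_def)
qed

end
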